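(* Let $\mathcal{A}$ be a countable structure for a countable language $L$, and let $\alpha\geq 2$ be a countable ordinal. If $\mathcal{A}$ has a $\Pi_\alpha$ Scott sentence, then for each finite tuple $\bar a$ from $\mathcal{A}$ the orbit of $\bar a$ under the automorphism group of $\mathcal{A}$ is defined in $\mathcal{A}$ (without parameters) by a $\Sigma_{<\alpha}$ formula.
   Context: Structures are countably infinite with universe $\omega$. $L_{\omega_1\omega}$-formulas (with finitely many free variables) in normal form are classified as follows. A formula is $\Sigma_0$ and $\Pi_0$ if it is finitary quantifier-free. For a countable ordinal $\alpha>0$, $\varphi(\bar x)$ is $\Sigma_\alpha$ if it is a countable disjunction of formulas $(\exists \bar u)\psi(\bar x,\bar u)$ where each $\psi$ is $\Pi_\beta$ for some $\beta<\alpha$; and $\varphi(\bar x)$ is $\Pi_\alpha$ if it is a countable conjunction of formulas $(\forall\bar u)\psi(\bar x,\bar u)$ where each $\psi$ is $\Sigma_\beta$ for some $\beta<\alpha$. A formula is $\Sigma_{<\alpha}$ if it is $\Sigma_\beta$ for some $\beta<\alpha$. A Scott sentence for $\mathcal{A}$ is a sentence of $L_{\omega_1\omega}$ whose countable models are exactly the isomorphic copies of $\mathcal{A}$. *)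

theory Defs
  imports Main "HOL-Library.Countable_Set_Type"
begin

section \<open>Languages and structures\<close>

text \<open>Constants are function symbols of arity 0. Only symbols in \<open>funs\<close> and \<open>rels\<close>
  belong to the language; the arity functions are irrelevant elsewhere.\<close>

record ('f, 'r) language =
  funs :: "'f set"
  rels :: "'r set"
  farity :: "'f \<Rightarrow> nat"
  rarity :: "'r \<Rightarrow> nat"

definition countable_language :: "('f, 'r) language \<Rightarrow> bool" where
  "countable_language L \<longleftrightarrow> countable (funs L) \<and> countable (rels L)"

text \<open>The universe is the whole type \<open>'a\<close>, so a structure with universe \<open>\<omega>\<close> is one with
  \<open>'a = nat\<close>. Interpretations are only ever consulted on argument lists whose length is the
  arity of the symbol; two structures that differ elsewhere are isomorphic.\<close>

record ('f, 'r, 'a) struct =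
  fun_int :: "'f \<Rightarrow> 'a list \<Rightarrow> 'a"
  rel_int :: "'r \<Rightarrow> 'a list \<Rightarrow> bool"

definition is_iso ::
  "('f, 'r) language \<Rightarrow> ('f, 'r, 'a) struct \<Rightarrow> ('f, 'r, 'b) struct \<Rightarrow> ('a \<Rightarrow> 'b) \<Rightarrow> bool" where
  "is_iso L A B h \<longleftrightarrow> bij h
    \<and> (\<forall>f\<in>funs L. \<forall>xs. length xs = farity L f \<longrightarrow> h (fun_int A f xs) = fun_int B f (map h xs))
    \<and> (\<forall>R\<in>rels L. \<forall>xs. length xs = rarity L R \<longrightarrow> rel_int A R xs = rel_int B R (map h xs))"

definition isomorphic ::
  "('f, 'r) language \<Rightarrow> ('f, 'r, 'a) struct \<Rightarrow> ('f, 'r, 'b) struct \<Rightarrow> bool" where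
  "isomorphic L A B \<longleftrightarrow> (\<exists>h. is_iso L A B h)"

definition orbit :: "('f, 'r) language \<Rightarrow> ('f, 'r, 'a) struct \<Rightarrow> 'a list \<Rightarrow> 'a list set" where
  "orbit L A as = {map h as | h. is_iso L A A h}"


section \<open>Formulas of \<open>L\<^bsub>\<omega>\<^sub>1\<omega>\<^esub>\<close>\<close>

datatype 'f tm = Var nat | App 'f "'f tm list"

datatype ('f, 'r) fm =
    Eq "'f tm" "'f tm"
  | Rel 'r "'f tm list"
  | Neg "('f, 'r) fm"
  | Conj "('f, 'r) fm cset"
  | Disj "('f, 'r) fm cset"
  | Ex nat "('f, 'r) fm"
  | All nat "('f, 'r) fm"

primrec fv_tm :: "'f tm \<Rightarrow> nat set" where
  "fv_tm (Var x) = {x}"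
| "fv_tm (App f ts) = \<Union> (set (map fv_tm ts))"

primrec fv :: "('f, 'r) fm \<Rightarrow> nat set" where
  "fv (Eq s t) = fv_tm s \<union> fv_tm t"
| "fv (Rel R ts) = (\<Union>t\<in>set ts. fv_tm t)"
| "fv (Neg \<phi>) = fv \<phi>"
| "fv (Conj C) = \<Union> (rcset (cimage fv C))"
| "fv (Disj C) = \<Union> (rcset (cimage fv C))"
| "fv (Ex x \<phi>) = fv \<phi> - {x}"
| "fv (All x \<phi>) = fv \<phi> - {x}"

primrec wf_tm :: "('f, 'r) language \<Rightarrow> 'f tm \<Rightarrow> bool" where
  "wf_tm L (Var x) \<longleftrightarrow> True"
| "wf_tm L (App f ts) \<longleftrightarrow> f \<in> funs L \<and> length ts = farity L f \<and> list_all id (map (wf_tm L) ts)"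

text \<open>Formulas of the language \<open>L\<close>: every formula, and hence every subformula, has only
  finitely many free variables.\<close>

primrec wf_fm :: "('f, 'r) language \<Rightarrow> ('f, 'r) fm \<Rightarrow> bool" where
  "wf_fm L (Eq s t) \<longleftrightarrow> wf_tm L s \<and> wf_tm L t"
| "wf_fm L (Rel R ts) \<longleftrightarrow> R \<in> rels L \<and> length ts = rarity L R \<and> (\<forall>t\<in>set ts. wf_tm L t)"
| "wf_fm L (Neg \<phi>) \<longleftrightarrow> wf_fm L \<phi>"
| "wf_fm L (Conj C) \<longleftrightarrow> finite (fv (Conj C)) \<and> cBall (cimage (wf_fm L) C) id"
| "wf_fm L (Disj C) \<longleftrightarrow> finite (fv (Disj C)) \<and> cBall (cimage (wf_fm L) C) id"
| "wf_fm L (Ex x \<phi>) \<longleftrightarrow> wf_fm L \<phi>"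
| "wf_fm L (All x \<phi>) \<longleftrightarrow> wf_fm L \<phi>"

primrec val :: "('f, 'r, 'a) struct \<Rightarrow> (nat \<Rightarrow> 'a) \<Rightarrow> 'f tm \<Rightarrow> 'a" where
  "val M e (Var x) = e x"
| "val M e (App f ts) = fun_int M f (map (val M e) ts)"

primrec sat :: "('f, 'r, 'a) struct \<Rightarrow> ('f, 'r) fm \<Rightarrow> (nat \<Rightarrow> 'a) \<Rightarrow> bool" where
  "sat M (Eq s t) = (\<lambda>e. val M e s = val M e t)"
| "sat M (Rel R ts) = (\<lambda>e. rel_int M R (map (val M e) ts))"
| "sat M (Neg \<phi>) = (\<lambda>e. \<not> sat M \<phi> e)"
| "sat M (Conj C) = (\<lambda>e. cBall (cimage (sat M) C) (\<lambda>P. P e))"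
| "sat M (Disj C) = (\<lambda>e. cBex (cimage (sat M) C) (\<lambda>P. P e))"
| "sat M (Ex x \<phi>) = (\<lambda>e. \<exists>a. sat M \<phi> (e(x := a)))"
| "sat M (All x \<phi>) = (\<lambda>e. \<forall>a. sat M \<phi> (e(x := a)))"

lemma cset_clauses:
  "fv (Conj C) = (\<Union>\<phi>\<in>rcset C. fv \<phi>)"
  "fv (Disj C) = (\<Union>\<phi>\<in>rcset C. fv \<phi>)"
  "wf_fm L (Conj C) \<longleftrightarrow> finite (fv (Conj C)) \<and> (\<forall>\<phi>\<in>rcset C. wf_fm L \<phi>)"
  "wf_fm L (Disj C) \<longleftrightarrow> finite (fv (Disj C)) \<and> (\<forall>\<phi>\<in>rcset C. wf_fm L \<phi>)"
  "sat M (Conj C) e \<longleftrightarrow> (\<forall>\<phi>\<in>rcset C. sat M \<phi> e)"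
  "sat M (Disj C) e \<longleftrightarrow> (\<exists>\<phi>\<in>rcset C. sat M \<phi> e)"
  by (auto simp: cBall.rep_eq cBex.rep_eq cimage.rep_eq)


section \<open>The hierarchy \<open>\<Sigma>\<^sub>\<alpha>\<close>, \<open>\<Pi>\<^sub>\<alpha>\<close>\<close>

inductive finitary_qf :: "('f, 'r) fm \<Rightarrow> bool" where
  "finitary_qf (Eq s t)"
| "finitary_qf (Rel R ts)"
| "finitary_qf \<phi> \<Longrightarrow> finitary_qf (Neg \<phi>)"
| "finite (rcset C) \<Longrightarrow> \<forall>\<phi>\<in>rcset C. finitary_qf \<phi> \<Longrightarrow> finitary_qf (Conj C)"
| "finite (rcset C) \<Longrightarrow> \<forall>\<phi>\<in>rcset C. finitary_qf \<phi> \<Longrightarrow> finitary_qf (Disj C)"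

text \<open>Ordinals are elements of an arbitrary well-ordered type: an element \<open>\<alpha>\<close> stands for the
  order type of \<open>{..<\<alpha>}\<close>, and the least element is the ordinal 0. Every ordinal arises in
  this way from a suitable type.\<close>

definition ord_zero :: "'o::wellorder" where
  "ord_zero = (LEAST \<beta>. True)"

inductive Sigma_fm :: "'o::wellorder \<Rightarrow> ('f, 'r) fm \<Rightarrow> bool"
  and Pi_fm :: "'o::wellorder \<Rightarrow> ('f, 'r) fm \<Rightarrow> bool" where
  "finitary_qf \<phi> \<Longrightarrow> Sigma_fm ord_zero \<phi>"
| "finitary_qf \<phi> \<Longrightarrow> Pi_fm ord_zero \<phi>"
| "ord_zero < \<alpha> \<Longrightarrow>
   \<forall>\<chi>\<in>rcset C. \<exists>us \<psi> \<beta>. \<chi> = foldr Ex us \<psi> \<and> \<beta> < \<alpha> \<and> Pi_fm \<beta> \<psi> \<Longrightarrow>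
   Sigma_fm \<alpha> (Disj C)"
| "ord_zero < \<alpha> \<Longrightarrow>
   \<forall>\<chi>\<in>rcset C. \<exists>us \<psi> \<beta>. \<chi> = foldr All us \<psi> \<and> \<beta> < \<alpha> \<and> Sigma_fm \<beta> \<psi> \<Longrightarrow>
   Pi_fm \<alpha> (Conj C)"

definition Sigma_less_fm :: "'o::wellorder \<Rightarrow> ('f, 'r) fm \<Rightarrow> bool" where
  "Sigma_less_fm \<alpha> \<phi> \<longleftrightarrow> (\<exists>\<beta><\<alpha>. Sigma_fm \<beta> \<phi>)"


section \<open>Definability and Scott sentences\<close>

text \<open>The formula \<open>\<phi>(x\<^sub>0, \<dots>, x\<^bsub>n-1\<^esub>)\<close> defines, without parameters, the set of \<open>n\<close>-tuples
  satisfying it in \<open>A\<close>.\<close>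

definition defines_in ::
  "('f, 'r) language \<Rightarrow> ('f, 'r, 'a) struct \<Rightarrow> nat \<Rightarrow> ('f, 'r) fm \<Rightarrow> 'a list set \<Rightarrow> bool" where
  "defines_in L A n \<phi> X \<longleftrightarrow> wf_fm L \<phi> \<and> fv \<phi> \<subseteq> {..<n} \<and> X = {map e [0..<n] | e. sat A \<phi> e}"

definition sentence :: "('f, 'r) language \<Rightarrow> ('f, 'r) fm \<Rightarrow> bool" where
  "sentence L \<phi> \<longleftrightarrow> wf_fm L \<phi> \<and> fv \<phi> = {}"

definition models :: "('f, 'r, 'a) struct \<Rightarrow> ('f, 'r) fm \<Rightarrow> bool" where
  "models M \<phi> \<longleftrightarrow> (\<forall>e. sat M \<phi> e)"

text \<open>All structures are countably infinite with universe \<open>\<omega>\<close>, so the countable models are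
  the models on \<open>nat\<close>.\<close>

definition scott_sentence ::
  "('f, 'r) language \<Rightarrow> ('f, 'r, nat) struct \<Rightarrow> ('f, 'r) fm \<Rightarrow> bool" where
  "scott_sentence L A \<phi> \<longleftrightarrow> sentence L \<phi>
    \<and> (\<forall>B :: ('f, 'r, nat) struct. models B \<phi> \<longleftrightarrow> isomorphic L A B)"

end

theory Submission
  imports Defs "HOL-Library.Sublist"
begin

text \<open>Call a tuple \<open>a\<close> supported if some \<open>\<Sigma>\<^bsub><\<alpha>\<^esub>\<close> formula \<open>\<theta>\<close> holds of \<open>a\<close> and every
  \<open>\<Sigma>\<^bsub><\<alpha>\<^esub>\<close> formula true of some tuple satisfying \<open>\<theta>\<close> is already true of \<open>a\<close>. If all tuples are
  supported, then satisfying each other's supports is a symmetric relation with the back-and-forth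
  property, so the support of \<open>a\<close> defines the orbit of \<open>a\<close>.

  If some \<open>a\<close> is not supported, its type can be omitted. Build a model \<open>B\<close> on \<open>nat\<close> from a generic
  sequence of finite conditions: each condition is a list of \<open>\<Pi>\<^sub>\<gamma>\<close> facts about elements of \<open>B\<close>,
  with \<open>\<gamma> < \<beta> < \<alpha>\<close> for some \<open>\<beta>\<close>, that come true in \<open>A\<close> under some bijection from \<open>B\<close> to \<open>A\<close>. The tuples
  of \<open>A\<close> that can play the role of a given tuple \<open>c\<close> of \<open>B\<close> form a \<open>\<Sigma>\<^bsub><\<alpha>\<^esub>\<close>-definable set, which
  cannot be a support of \<open>a\<close>; hence one more fact keeps \<open>a\<close> from playing that role. A \<open>\<Pi>\<^sub>\<alpha>\<close> sentence
  true in \<open>A\<close> is true in \<open>B\<close>, because each instance \<open>\<theta>\<close> of its conjuncts is \<open>\<Sigma>\<^bsub><\<alpha>\<^esub>\<close> and so is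
  witnessed by a single admissible fact. Thus \<open>B\<close> satisfies the Scott sentence of \<open>A\<close>; but for an
  isomorphism \<open>h\<close> from \<open>A\<close> to \<open>B\<close> the tuple \<open>a\<close> does play the role of \<open>h a\<close>, a contradiction.\<close>

section \<open>Environments, quantifier blocks and invariance\<close>

text \<open>A quantifier block may repeat a variable. Updating from left to right lets the last
  occurrence win, which agrees with the innermost quantifier.\<close>

fun upds :: "(nat \<Rightarrow> 'a) \<Rightarrow> nat list \<Rightarrow> 'a list \<Rightarrow> nat \<Rightarrow> 'a" where
  "upds e (x # xs) (v # vs) = upds (e(x := v)) xs vs"
| "upds e _ _ = e"

lemma comp_fun_upd: "g \<circ> e(x := v) = (g \<circ> e)(x := g v)"
  by auto

lemma comp_upds: "g \<circ> upds e us vs = upds (g \<circ> e) us (map g vs)"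
proof (induction e us vs rule: upds.induct)
  case (1 e x xs v vs)
  show ?case unfolding list.map upds.simps 1 comp_fun_upd ..
qed simp_all

lemma upds_notin: "x \<notin> set us \<Longrightarrow> upds e us vs x = e x"
  by (induction e us vs rule: upds.induct) auto

lemma upds_in: "x \<in> set us \<Longrightarrow> length vs = length us \<Longrightarrow> upds e us vs x \<in> set vs"
  by (induction e us vs rule: upds.induct) (auto, metis fun_upd_same upds_notin)

lemma upds_cong:
  "length vs = length us \<Longrightarrow> (x \<notin> set us \<Longrightarrow> e x = e' x) \<Longrightarrow> upds e us vs x = upds e' us vs x"
proof (induction e us vs arbitrary: e' rule: upds.induct)
  case (1 e y xs v vs)
  show ?case unfolding upds.simps by (rule "1.IH") (use "1.prems" in auto)
qed auto

lemma map_upds_distinct: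
  "distinct us \<Longrightarrow> length vs = length us \<Longrightarrow> map (upds e us vs) us = vs"
  by (induction e us vs rule: upds.induct) (auto simp: upds_notin)

lemma quant_length_Suc:
  "(\<exists>vs. length vs = Suc n \<and> P vs) \<longleftrightarrow> (\<exists>v vs. length vs = n \<and> P (v # vs))"
  "(\<forall>vs. length vs = Suc n \<longrightarrow> P vs) \<longleftrightarrow> (\<forall>v vs. length vs = n \<longrightarrow> P (v # vs))"
  by (metis length_Suc_conv)+

section \<open>Quantifier blocks\<close>

lemma sat_foldr_Ex:
  "sat M (foldr Ex us \<phi>) e \<longleftrightarrow> (\<exists>vs. length vs = length us \<and> sat M \<phi> (upds e us vs))"
proof (induction us arbitrary: e)
  case (Cons x us)
  show ?case
    by (simp add: Cons.IH quant_length_Suc del: fun_upd_apply)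
qed simp

lemma sat_foldr_All:
  "sat M (foldr All us \<phi>) e \<longleftrightarrow> (\<forall>vs. length vs = length us \<longrightarrow> sat M \<phi> (upds e us vs))"
proof (induction us arbitrary: e)
  case (Cons x us)
  show ?case
    by (simp add: Cons.IH quant_length_Suc del: fun_upd_apply)
qed simp

lemma fv_foldr_Ex [simp]: "fv (foldr Ex us \<phi>) = fv \<phi> - set us"
  by (induction us) auto

lemma fv_foldr_All [simp]: "fv (foldr All us \<phi>) = fv \<phi> - set us"
  by (induction us) auto

lemma wf_foldr_Ex [simp]: "wf_fm L (foldr Ex us \<phi>) = wf_fm L \<phi>"
  by (induction us) auto

lemma wf_foldr_All [simp]: "wf_fm L (foldr All us \<phi>) = wf_fm L \<phi>"
  by (induction us) auto

lemma foldr_All_cancel: "foldr All us \<phi> = foldr All us \<psi> \<longleftrightarrow> \<phi> = \<psi>"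
  by (induction us) auto

lemma rcset_acset: "countable S \<Longrightarrow> rcset (acset S) = S"
  by (simp add: acset_inverse)

lemma fv_member: "\<chi> \<in> rcset C \<Longrightarrow> fv \<chi> \<subseteq> fv (Conj C)" "\<chi> \<in> rcset C \<Longrightarrow> fv \<chi> \<subseteq> fv (Disj C)"
  unfolding cset_clauses by blast+

lemma wf_fm_member:
  "\<chi> \<in> rcset C \<Longrightarrow> wf_fm L (Conj C) \<Longrightarrow> wf_fm L \<chi>"
  "\<chi> \<in> rcset C \<Longrightarrow> wf_fm L (Disj C) \<Longrightarrow> wf_fm L \<chi>"
  unfolding cset_clauses by blast+

lemma finite_fv_tm: "finite (fv_tm t)"
  by (induction t) auto

text \<open>Infinitary formulas owe this to \<open>wf_fm\<close>. It ensures that each fact of a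
  condition mentions only finitely many elements.\<close>

lemma finite_fv: "wf_fm L \<phi> \<Longrightarrow> finite (fv \<phi>)"
proof (induction \<phi>)
  case (Conj C)
  then show ?case by (simp only: cset_clauses)
next
  case (Disj C)
  then show ?case by (simp only: cset_clauses)
qed (auto simp: finite_fv_tm)

section \<open>Dependence on free variables and invariance under isomorphism\<close>

lemma val_cong: "\<forall>x\<in>fv_tm t. e x = e' x \<Longrightarrow> val M e t = val M e' t"
proof (induction t)
  case (App f ts)
  then have "map (val M e) ts = map (val M e') ts" by auto
  then show ?case by (metis val.simps(2))
qed simp

lemma sat_cong: "\<forall>x\<in>fv \<phi>. e x = e' x \<Longrightarrow> sat M \<phi> e = sat M \<phi> e'"
proof (induction \<phi> arbitrary: e e')
  case (Eq s t)
  then show ?case using val_cong[of s e e' M] val_cong[of t e e' M] by auto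
next
  case (Rel R ts)
  then have "map (val M e) ts = map (val M e') ts" by (auto intro!: val_cong)
  then show ?case by (metis sat.simps(2))
next
  case (Neg \<phi>)
  then show ?case by (metis fv.simps(3) sat.simps(3))
next
  case (Conj C)
  have "sat M \<chi> e = sat M \<chi> e'" if "\<chi> \<in> rcset C" for \<chi>
    using Conj.prems that unfolding cset_clauses by (intro Conj.IH[OF that]) blast
  then show ?case unfolding cset_clauses by blast
next
  case (Disj C)
  have "sat M \<chi> e = sat M \<chi> e'" if "\<chi> \<in> rcset C" for \<chi>
    using Disj.prems that unfolding cset_clauses by (intro Disj.IH[OF that]) blast
  then show ?case unfolding cset_clauses by blast
next
  case (Ex x \<phi>)
  then have "sat M \<phi> (e(x := a)) = sat M \<phi> (e'(x := a))" for a by auto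
  then show ?case by simp
next
  case (All x \<phi>)
  then have "sat M \<phi> (e(x := a)) = sat M \<phi> (e'(x := a))" for a by auto
  then show ?case by simp
qed

lemma val_iso:
  assumes "is_iso L A B h"
  shows "wf_tm L t \<Longrightarrow> h (val A e t) = val B (h \<circ> e) t"
proof (induction t)
  case (App f ts)
  have "val B (h \<circ> e) t = h (val A e t)" if "t \<in> set ts" for t
    using App that by (simp add: list_all_iff del: o_apply)
  then have "map (val B (h \<circ> e)) ts = map h (map (val A e) ts)"
    by (intro nth_equalityI) (simp_all del: o_apply map_map)
  then show ?case using App.prems assms
    by (simp add: is_iso_def del: map_map o_apply)
qed simp

lemma sat_iso:
  assumes "is_iso L A B h"
  shows "wf_fm L \<phi> \<Longrightarrow> sat A \<phi> e = sat B \<phi> (h \<circ> e)"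
proof -
  have surj: "(\<exists>b. P b) \<longleftrightarrow> (\<exists>a. P (h a))" "(\<forall>b. P b) \<longleftrightarrow> (\<forall>a. P (h a))" for P
    using bij_is_surj[of h] assms unfolding is_iso_def surj_def by metis+
  show "wf_fm L \<phi> \<Longrightarrow> ?thesis"
  proof (induction \<phi> arbitrary: e)
    case (Eq s t)
    have "inj h" using assms by (simp add: is_iso_def bij_is_inj)
    then show ?case
      using Eq by (simp add: val_iso[OF assms, symmetric] inj_eq del: o_apply)
  next
    case (Rel R ts)
    then have "map (val B (h \<circ> e)) ts = map h (map (val A e) ts)"
      by (intro nth_equalityI) (simp_all add: val_iso[OF assms, symmetric] del: o_apply map_map)
    then show ?case using Rel.prems assms
      by (simp add: is_iso_def del: map_map o_apply)
  next
    case (Neg \<phi>)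
    then show ?case by simp
  next
    case (Conj C)
    then show ?case unfolding cset_clauses by blast
  next
    case (Disj C)
    then show ?case unfolding cset_clauses by blast
  next
    case (Ex x \<phi>)
    have "sat A \<phi> (e(x := a)) = sat B \<phi> ((h \<circ> e)(x := h a))" for a
      using Ex.IH[of "e(x := a)"] Ex.prems unfolding comp_fun_upd wf_fm.simps by blast
    then show ?case unfolding sat.simps by (simp only: surj)
  next
    case (All x \<phi>)
    have "sat A \<phi> (e(x := a)) = sat B \<phi> ((h \<circ> e)(x := h a))" for a
      using All.IH[of "e(x := a)"] All.prems unfolding comp_fun_upd wf_fm.simps by blast
    then show ?case unfolding sat.simps by (simp only: surj)
  qed
qed

lemma isomorphic_refl: "isomorphic L A A"
  unfolding isomorphic_def is_iso_def by (intro exI[of _ id]) auto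


section \<open>Renaming free variables\<close>

primrec ren_tm :: "(nat \<Rightarrow> nat) \<Rightarrow> 'f tm \<Rightarrow> 'f tm" where
  "ren_tm \<sigma> (Var x) = Var (\<sigma> x)"
| "ren_tm \<sigma> (App f ts) = App f (map (ren_tm \<sigma>) ts)"

lemma fv_ren_tm [simp]: "fv_tm (ren_tm \<sigma> t) = \<sigma> ` fv_tm t"
  by (induction t) auto

lemma wf_ren_tm [simp]: "wf_tm L (ren_tm \<sigma> t) = wf_tm L t"
  by (induction t) (auto simp: list_all_iff)

lemma val_ren_tm [simp]: "val M e (ren_tm \<sigma> t) = val M (e \<circ> \<sigma>) t"
proof (induction t)
  case (App f ts)
  then have "map (val M e) (map (ren_tm \<sigma>) ts) = map (val M (e \<circ> \<sigma>)) ts"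
    by (intro nth_equalityI) (simp_all del: o_apply map_map)
  then show ?case by (metis ren_tm.simps(2) val.simps(2))
qed simp

lemma wf_fv_Conj:
  assumes "\<forall>\<chi>\<in>rcset C. wf_fm L \<chi> \<and> fv \<chi> \<subseteq> {..<n}"
  shows "wf_fm L (Conj C)" and "fv (Conj C) \<subseteq> {..<n}"
proof -
  show "fv (Conj C) \<subseteq> {..<n}" using assms unfolding cset_clauses by blast
  then show "wf_fm L (Conj C)"
    using assms finite_subset[OF _ finite_lessThan] unfolding cset_clauses by blast
qed

lemma wf_fv_Disj:
  assumes "\<forall>\<chi>\<in>rcset C. wf_fm L \<chi> \<and> fv \<chi> \<subseteq> {..<n}"
  shows "wf_fm L (Disj C)" and "fv (Disj C) \<subseteq> {..<n}"
proof -
  show "fv (Disj C) \<subseteq> {..<n}" using assms unfolding cset_clauses by blast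
  then show "wf_fm L (Disj C)"
    using assms finite_subset[OF _ finite_lessThan] unfolding cset_clauses by blast
qed

text \<open>Renaming is specified by its effect on satisfaction rather than by a substitution
  function, so bound variables may be chosen afresh at each level. The bound \<open>n\<close> also
  marks where fresh variables start.\<close>

definition renames ::
  "('f, 'r) language \<Rightarrow> nat \<Rightarrow> (nat \<Rightarrow> nat) \<Rightarrow> ('f, 'r) fm \<Rightarrow> ('f, 'r) fm \<Rightarrow> bool" where
  "renames L n \<sigma> \<phi> \<phi>' \<longleftrightarrow> wf_fm L \<phi>' \<and> fv \<phi>' \<subseteq> {..<n} \<and>
    (\<forall>(M :: ('f, 'r, nat) struct) e. sat M \<phi>' e = sat M \<phi> (e \<circ> \<sigma>))"

lemma renames_Conj:
  assumes "\<forall>\<chi>\<in>rcset C. renames L n \<sigma> \<chi> (g \<chi>)"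
  shows "renames L n \<sigma> (Conj C) (Conj (cimage g C))"
  unfolding renames_def
proof (intro conjI allI)
  have *: "\<forall>\<chi>\<in>rcset (cimage g C). wf_fm L \<chi> \<and> fv \<chi> \<subseteq> {..<n}"
    using assms by (simp add: renames_def cimage.rep_eq)
  show "wf_fm L (Conj (cimage g C))" "fv (Conj (cimage g C)) \<subseteq> {..<n}"
    using wf_fv_Conj[OF *] by blast+
  show "sat M (Conj (cimage g C)) e = sat M (Conj C) (e \<circ> \<sigma>)" for M :: "('a, 'b, nat) struct" and e
    unfolding cset_clauses cimage.rep_eq using assms by (simp add: renames_def del: o_apply)
qed

lemma renames_Disj:
  assumes "\<forall>\<chi>\<in>rcset C. renames L n \<sigma> \<chi> (g \<chi>)"
  shows "renames L n \<sigma> (Disj C) (Disj (cimage g C))"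
  unfolding renames_def
proof (intro conjI allI)
  have *: "\<forall>\<chi>\<in>rcset (cimage g C). wf_fm L \<chi> \<and> fv \<chi> \<subseteq> {..<n}"
    using assms by (simp add: renames_def cimage.rep_eq)
  show "wf_fm L (Disj (cimage g C))" "fv (Disj (cimage g C)) \<subseteq> {..<n}"
    using wf_fv_Disj[OF *] by blast+
  show "sat M (Disj (cimage g C)) e = sat M (Disj C) (e \<circ> \<sigma>)" for M :: "('a, 'b, nat) struct" and e
    unfolding cset_clauses cimage.rep_eq using assms by (simp add: renames_def del: o_apply)
qed

lemma map_val_ren_tm: "map (val M e) (map (ren_tm \<sigma>) ts) = map (val M (e \<circ> \<sigma>)) ts"
  by (intro nth_equalityI) (simp_all del: o_apply map_map)

lemma rename_qf:
  assumes "finitary_qf \<phi>"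
  shows "wf_fm L \<phi> \<Longrightarrow> \<sigma> ` fv \<phi> \<subseteq> {..<n} \<Longrightarrow> \<exists>\<phi>'. finitary_qf \<phi>' \<and> renames L n \<sigma> \<phi> \<phi>'"
  using assms
proof (induction \<phi> rule: finitary_qf.induct)
  case (1 s t)
  then show ?case
    by (intro exI[of _ "Eq (ren_tm \<sigma> s) (ren_tm \<sigma> t)"])
      (auto simp: renames_def finitary_qf.intros simp del: o_apply)
next
  case (2 R ts)
  then show ?case
    by (intro exI[of _ "Rel R (map (ren_tm \<sigma>) ts)"])
      (simp add: renames_def finitary_qf.intros map_val_ren_tm UN_subset_iff image_UN del: map_map o_apply)
next
  case (3 \<phi>)
  then obtain \<phi>' where "finitary_qf \<phi>'" "renames L n \<sigma> \<phi> \<phi>'" by auto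
  then show ?case
    by (intro exI[of _ "Neg \<phi>'"]) (auto simp: renames_def finitary_qf.intros simp del: o_apply)
next
  case (4 C)
  have "\<forall>\<chi>\<in>rcset C. \<exists>\<phi>'. finitary_qf \<phi>' \<and> renames L n \<sigma> \<chi> \<phi>'"
    using 4 unfolding cset_clauses by (simp add: image_UN UN_subset_iff)
  then obtain g where "\<forall>\<chi>\<in>rcset C. finitary_qf (g \<chi>) \<and> renames L n \<sigma> \<chi> (g \<chi>)" by metis
  then show ?case using 4(1)
    by (intro exI[of _ "Conj (cimage g C)"])
      (auto intro!: finitary_qf.intros renames_Conj simp: cimage.rep_eq)
next
  case (5 C)
  have "\<forall>\<chi>\<in>rcset C. \<exists>\<phi>'. finitary_qf \<phi>' \<and> renames L n \<sigma> \<chi> \<phi>'"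
    using 5 unfolding cset_clauses by (simp add: image_UN UN_subset_iff)
  then obtain g where "\<forall>\<chi>\<in>rcset C. finitary_qf (g \<chi>) \<and> renames L n \<sigma> \<chi> (g \<chi>)" by metis
  then show ?case using 5(1)
    by (intro exI[of _ "Disj (cimage g C)"])
      (auto intro!: finitary_qf.intros renames_Disj simp: cimage.rep_eq)
qed

text \<open>Sending the block to distinct variables from \<open>n\<close> on turns an assignment of
  \<open>ws\<close> to the new block into an assignment of \<open>ws\<close> to the old one. The
  remaining free variables are sent below \<open>n\<close>, where the new block changes
  nothing.\<close>

lemma renames_block:
  assumes "renames L (n + length us) (upds \<sigma> us [n..<n + length us]) \<theta> \<theta>'"
    and "\<sigma> ` (fv \<theta> - set us) \<subseteq> {..<n}"
  shows "renames L n \<sigma> (foldr All us \<theta>) (foldr All [n..<n + length us] \<theta>')"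
    and "renames L n \<sigma> (foldr Ex us \<theta>) (foldr Ex [n..<n + length us] \<theta>')"
proof -
  let ?vs = "[n..<n + length us]"
  have wf: "wf_fm L \<theta>'" and fv: "fv \<theta>' - set ?vs \<subseteq> {..<n}"
    using assms(1) by (auto simp: renames_def)
  have *: "sat M \<theta>' (upds e ?vs ws) = sat M \<theta> (upds (e \<circ> \<sigma>) us ws)"
    if ws: "length ws = length us" for M :: "('a, 'b, nat) struct" and e ws
  proof -
    let ?e = "upds e ?vs ws"
    have "sat M \<theta>' ?e = sat M \<theta> (?e \<circ> upds \<sigma> us ?vs)"
      using assms(1) by (simp add: renames_def)
    also have "?e \<circ> upds \<sigma> us ?vs = upds (?e \<circ> \<sigma>) us ws"
      using ws by (simp add: comp_upds map_upds_distinct)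
    also have "sat M \<theta> \<dots> = sat M \<theta> (upds (e \<circ> \<sigma>) us ws)"
    proof (intro sat_cong ballI upds_cong)
      fix x assume "x \<in> fv \<theta>" "x \<notin> set us"
      then have "\<sigma> x < n" using assms(2) by auto
      then show "(?e \<circ> \<sigma>) x = (e \<circ> \<sigma>) x" by (simp add: upds_notin)
    qed (use ws in simp)
    finally show ?thesis .
  qed
  show "renames L n \<sigma> (foldr All us \<theta>) (foldr All ?vs \<theta>')"
    "renames L n \<sigma> (foldr Ex us \<theta>) (foldr Ex ?vs \<theta>')"
    unfolding renames_def sat_foldr_All sat_foldr_Ex length_upt
    using wf fv by (simp_all add: * cong: conj_cong imp_cong)
qed

lemma upds_fresh_image:
  assumes "\<sigma> ` (S - set us) \<subseteq> {..<n}"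
  shows "upds \<sigma> us [n..<n + length us] ` S \<subseteq> {..<n + length us}"
proof
  fix y assume "y \<in> upds \<sigma> us [n..<n + length us] ` S"
  then obtain x where x: "x \<in> S" "y = upds \<sigma> us [n..<n + length us] x" by auto
  show "y \<in> {..<n + length us}"
  proof (cases "x \<in> set us")
    case True
    then show ?thesis using upds_in[of x us "[n..<n + length us]" \<sigma>] x(2) by simp
  next
    case False
    then have "\<sigma> x < n" using assms x(1) by auto
    then show ?thesis using False x(2) by (simp add: upds_notin)
  qed
qed

lemma Pi_fm_cases:
  assumes "Pi_fm \<gamma> \<psi>"
  obtains "\<gamma> = ord_zero" "finitary_qf \<psi>"
  | C where "ord_zero < \<gamma>" "\<psi> = Conj C"
    "\<forall>\<chi>\<in>rcset C. \<exists>us \<theta> \<delta>. \<chi> = foldr All us \<theta> \<and> \<delta> < \<gamma> \<and> Sigma_fm \<delta> \<theta>"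
  using assms by (cases rule: Pi_fm.cases) auto

lemma Sigma_fm_cases:
  assumes "Sigma_fm \<gamma> \<psi>"
  obtains "\<gamma> = ord_zero" "finitary_qf \<psi>"
  | C where "ord_zero < \<gamma>" "\<psi> = Disj C"
    "\<forall>\<chi>\<in>rcset C. \<exists>us \<theta> \<delta>. \<chi> = foldr Ex us \<theta> \<and> \<delta> < \<gamma> \<and> Pi_fm \<delta> \<theta>"
  using assms by (cases rule: Sigma_fm.cases) auto

text \<open>Quantifier blocks are moved to the fresh variables from \<open>n\<close> on, so nothing is captured.\<close>

lemma rename_Pi_Sigma:
  fixes \<gamma> :: "'o::wellorder"
  assumes "wf_fm L \<phi>" and "\<sigma> ` fv \<phi> \<subseteq> {..<n}"
  shows "(Pi_fm \<gamma> \<phi> \<longrightarrow> (\<exists>\<phi>'. Pi_fm \<gamma> \<phi>' \<and> renames L n \<sigma> \<phi> \<phi>')) \<and>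
    (Sigma_fm \<gamma> \<phi> \<longrightarrow> (\<exists>\<phi>'. Sigma_fm \<gamma> \<phi>' \<and> renames L n \<sigma> \<phi> \<phi>'))"
  using assms
proof (induction \<gamma> arbitrary: \<phi> \<sigma> n rule: less_induct)
  case (less \<gamma>)
  show ?case
  proof (intro conjI impI)
    assume "Pi_fm \<gamma> \<phi>"
    then show "\<exists>\<phi>'. Pi_fm \<gamma> \<phi>' \<and> renames L n \<sigma> \<phi> \<phi>'"
    proof (cases rule: Pi_fm_cases)
      case 1
      then show ?thesis using rename_qf[of \<phi> L \<sigma> n] less.prems Sigma_fm_Pi_fm.intros(2) by blast
    next
      case (2 C)
      have "\<exists>\<chi>'. (\<exists>us \<theta> \<delta>. \<chi>' = foldr All us \<theta> \<and> \<delta> < \<gamma> \<and> Sigma_fm \<delta> \<theta>) \<and> renames L n \<sigma> \<chi> \<chi>'"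
        if \<chi>: "\<chi> \<in> rcset C" for \<chi>
      proof -
        obtain us \<theta> \<delta> where us: "\<chi> = foldr All us \<theta>" "\<delta> < \<gamma>" "Sigma_fm \<delta> \<theta>"
          using 2 \<chi> by auto
        have wf: "wf_fm L \<theta>" and fv: "\<sigma> ` (fv \<theta> - set us) \<subseteq> {..<n}"
          using wf_fm_member[OF \<chi>, of L] fv_member[OF \<chi>] less.prems
          by (simp_all only: 2(2) us(1) wf_foldr_All wf_foldr_Ex fv_foldr_All fv_foldr_Ex) blast+
        \<comment> \<open>The matrix of a \<Pi> conjunct is a \<Sigma> formula of lower level, and
          vice versa, so both claims go through one induction.\<close>
        obtain \<theta>' where "Sigma_fm \<delta> \<theta>'"
          "renames L (n + length us) (upds \<sigma> us [n..<n + length us]) \<theta> \<theta>'"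
          using less.IH[OF us(2) wf upds_fresh_image[OF fv]] us(3) by blast
        then show ?thesis
          using us(1,2) renames_block(1)[OF _ fv, of L \<theta>']
          by (intro exI[of _ "foldr All [n..<n + length us] \<theta>'"] conjI exI[of _ "[n..<n + length us]"]
            exI[of _ \<theta>'] exI[of _ \<delta>]) simp_all
      qed
      then have "\<forall>\<chi>\<in>rcset C. \<exists>\<chi>'.
        (\<exists>us \<theta> \<delta>. \<chi>' = foldr All us \<theta> \<and> \<delta> < \<gamma> \<and> Sigma_fm \<delta> \<theta>) \<and> renames L n \<sigma> \<chi> \<chi>'"
        by (rule ballI)
      from bchoice[OF this] obtain g where g: "\<forall>\<chi>\<in>rcset C.
        (\<exists>us \<theta> \<delta>. g \<chi> = foldr All us \<theta> \<and> \<delta> < \<gamma> \<and> Sigma_fm \<delta> \<theta>) \<and> renames L n \<sigma> \<chi> (g \<chi>)" ..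
      have "Pi_fm \<gamma> (Conj (cimage g C))"
        using g 2 by (intro Sigma_fm_Pi_fm.intros(4)) (simp_all add: cimage.rep_eq)
      then show ?thesis using renames_Conj[of C L n \<sigma> g] g 2(2)
        by (intro exI[of _ "Conj (cimage g C)"]) simp
    qed
  next
    assume "Sigma_fm \<gamma> \<phi>"
    then show "\<exists>\<phi>'. Sigma_fm \<gamma> \<phi>' \<and> renames L n \<sigma> \<phi> \<phi>'"
    proof (cases rule: Sigma_fm_cases)
      case 1
      then show ?thesis using rename_qf[of \<phi> L \<sigma> n] less.prems Sigma_fm_Pi_fm.intros(1) by blast
    next
      case (2 C)
      have "\<exists>\<chi>'. (\<exists>us \<theta> \<delta>. \<chi>' = foldr Ex us \<theta> \<and> \<delta> < \<gamma> \<and> Pi_fm \<delta> \<theta>) \<and> renames L n \<sigma> \<chi> \<chi>'"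
        if \<chi>: "\<chi> \<in> rcset C" for \<chi>
      proof -
        obtain us \<theta> \<delta> where us: "\<chi> = foldr Ex us \<theta>" "\<delta> < \<gamma>" "Pi_fm \<delta> \<theta>"
          using 2 \<chi> by auto
        have wf: "wf_fm L \<theta>" and fv: "\<sigma> ` (fv \<theta> - set us) \<subseteq> {..<n}"
          using wf_fm_member[OF \<chi>, of L] fv_member[OF \<chi>] less.prems
          by (simp_all only: 2(2) us(1) wf_foldr_All wf_foldr_Ex fv_foldr_All fv_foldr_Ex) blast+
        obtain \<theta>' where "Pi_fm \<delta> \<theta>'"
          "renames L (n + length us) (upds \<sigma> us [n..<n + length us]) \<theta> \<theta>'"
          using less.IH[OF us(2) wf upds_fresh_image[OF fv]] us(3) by blast
        then show ?thesis
          using us(1,2) renames_block(2)[OF _ fv, of L \<theta>']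
          by (intro exI[of _ "foldr Ex [n..<n + length us] \<theta>'"] conjI exI[of _ "[n..<n + length us]"]
            exI[of _ \<theta>'] exI[of _ \<delta>]) simp_all
      qed
      then have "\<forall>\<chi>\<in>rcset C. \<exists>\<chi>'.
        (\<exists>us \<theta> \<delta>. \<chi>' = foldr Ex us \<theta> \<and> \<delta> < \<gamma> \<and> Pi_fm \<delta> \<theta>) \<and> renames L n \<sigma> \<chi> \<chi>'"
        by (rule ballI)
      from bchoice[OF this] obtain g where g: "\<forall>\<chi>\<in>rcset C.
        (\<exists>us \<theta> \<delta>. g \<chi> = foldr Ex us \<theta> \<and> \<delta> < \<gamma> \<and> Pi_fm \<delta> \<theta>) \<and> renames L n \<sigma> \<chi> (g \<chi>)" ..
      have "Sigma_fm \<gamma> (Disj (cimage g C))"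
        using g 2 by (intro Sigma_fm_Pi_fm.intros(3)) (simp_all add: cimage.rep_eq)
      then show ?thesis using renames_Disj[of C L n \<sigma> g] g 2(2)
        by (intro exI[of _ "Disj (cimage g C)"]) simp
    qed
  qed
qed

section \<open>Closure properties of the hierarchy\<close>

lemma ord_zero_le: "ord_zero \<le> \<gamma>"
  unfolding ord_zero_def by (rule Least_le) simp

lemma ord_zero_less: "ord_zero < \<gamma> \<longleftrightarrow> \<gamma> \<noteq> ord_zero"
  using ord_zero_le[of \<gamma>] by auto

text \<open>Two formulas can be merged once both are conjunctions at a common positive level. A
  quantifier-free formula becomes a singleton conjunction with an empty block; any other is a
  conjunction already, whose matrices stay below the larger level.\<close>

lemma Pi_fm_as_Conj:
  fixes \<gamma> \<gamma>' :: "'o::wellorder"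
  assumes "Pi_fm \<gamma> \<psi>" and "\<gamma> \<le> \<gamma>'" and "ord_zero < \<gamma>'"
    and "wf_fm L \<psi>" and "fv \<psi> \<subseteq> {..<n}"
  shows "\<exists>C. Pi_fm \<gamma>' (Conj C) \<and> renames L n id \<psi> (Conj C)"
  using assms(1)
proof (cases rule: Pi_fm_cases)
  case 1
  have *: "rcset (acset {\<psi>}) = {\<psi>}" by (simp add: rcset_acset)
  have "Pi_fm \<gamma>' (Conj (acset {\<psi>}))"
    using 1(2) assms(3) unfolding *
    by (intro Sigma_fm_Pi_fm.intros(4))
      (auto simp: * intro!: exI[of _ "[]"] exI[of _ ord_zero] Sigma_fm_Pi_fm.intros(1))
  moreover have "renames L n id \<psi> (Conj (acset {\<psi>}))"
    using assms(4,5) wf_fv_Conj[of "acset {\<psi>}" L n] by (simp add: renames_def cset_clauses * del: sat.simps fv.simps wf_fm.simps)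
  ultimately show ?thesis by blast
next
  case (2 C)
  have "Pi_fm \<gamma>' (Conj C)"
    using 2(3) assms(2,3) by (intro Sigma_fm_Pi_fm.intros(4)) (meson order_less_le_trans)+
  moreover have "renames L n id \<psi> (Conj C)"
    using assms(4,5) 2(2) by (simp add: renames_def del: sat.simps fv.simps wf_fm.simps)
  ultimately show ?thesis by blast
qed

text \<open>At a positive level the two countable families of conjuncts are united. At level 0 the
  result has to remain quantifier-free, so the two formulas themselves are the conjuncts.\<close>

lemma Pi_fm_conj:
  fixes \<gamma>1 \<gamma>2 :: "'o::wellorder"
  assumes "Pi_fm \<gamma>1 \<psi>1" "wf_fm L \<psi>1" "fv \<psi>1 \<subseteq> {..<n}"
    and "Pi_fm \<gamma>2 \<psi>2" "wf_fm L \<psi>2" "fv \<psi>2 \<subseteq> {..<n}"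
  shows "\<exists>\<psi>. Pi_fm (max \<gamma>1 \<gamma>2) \<psi> \<and> wf_fm L \<psi> \<and> fv \<psi> \<subseteq> {..<n} \<and>
    (\<forall>(M :: ('f, 'r, nat) struct) e. sat M \<psi> e \<longleftrightarrow> sat M \<psi>1 e \<and> sat M \<psi>2 e)"
proof (cases "max \<gamma>1 \<gamma>2 = ord_zero")
  case True
  then have "\<gamma>1 = ord_zero" "\<gamma>2 = ord_zero"
    using ord_zero_le[of \<gamma>1] ord_zero_le[of \<gamma>2] by (auto simp: max_def split: if_splits)
  then have qf: "finitary_qf \<psi>1" "finitary_qf \<psi>2"
    using assms(1,4) by (auto elim: Pi_fm_cases)
  have *: "rcset (acset {\<psi>1, \<psi>2}) = {\<psi>1, \<psi>2}" by (simp add: rcset_acset)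
  have "Pi_fm (max \<gamma>1 \<gamma>2) (Conj (acset {\<psi>1, \<psi>2}))"
    unfolding True using qf by (auto intro!: Sigma_fm_Pi_fm.intros finitary_qf.intros simp: *)
  moreover have "sat M (Conj (acset {\<psi>1, \<psi>2})) e \<longleftrightarrow> sat M \<psi>1 e \<and> sat M \<psi>2 e"
    for M :: "('f, 'r, nat) struct" and e
    unfolding cset_clauses * by simp
  moreover have **: "\<forall>\<chi>\<in>rcset (acset {\<psi>1, \<psi>2}). wf_fm L \<chi> \<and> fv \<chi> \<subseteq> {..<n}"
    using assms by (simp add: *)
  ultimately show ?thesis using wf_fv_Conj[OF **] by blast
next
  case False
  then have pos: "ord_zero < max \<gamma>1 \<gamma>2" by (simp add: ord_zero_less)
  obtain C1 where C1: "Pi_fm (max \<gamma>1 \<gamma>2) (Conj C1)" "renames L n id \<psi>1 (Conj C1)"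
    using Pi_fm_as_Conj[OF assms(1) max.cobounded1 pos assms(2,3)] by blast
  obtain C2 where C2: "Pi_fm (max \<gamma>1 \<gamma>2) (Conj C2)" "renames L n id \<psi>2 (Conj C2)"
    using Pi_fm_as_Conj[OF assms(4) max.cobounded2 pos assms(5,6)] by blast
  have *: "rcset (cUn C1 C2) = rcset C1 \<union> rcset C2" by (simp add: sup_cset.rep_eq)
  have "\<forall>\<chi>\<in>rcset C. \<exists>us \<theta> \<delta>. \<chi> = foldr All us \<theta> \<and> \<delta> < max \<gamma>1 \<gamma>2 \<and> Sigma_fm \<delta> \<theta>"
    if "Pi_fm (max \<gamma>1 \<gamma>2) (Conj C)" for C :: "('f, 'r) fm cset"
    using that False by (cases rule: Pi_fm_cases) auto
  then have "Pi_fm (max \<gamma>1 \<gamma>2) (Conj (cUn C1 C2))"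
    using C1(1) C2(1) pos by (intro Sigma_fm_Pi_fm.intros(4)) (auto simp: *)
  moreover have "sat M (Conj (cUn C1 C2)) e \<longleftrightarrow> sat M \<psi>1 e \<and> sat M \<psi>2 e"
    for M :: "('f, 'r, nat) struct" and e
  proof -
    have "sat M (Conj (cUn C1 C2)) e \<longleftrightarrow> sat M (Conj C1) e \<and> sat M (Conj C2) e"
      unfolding cset_clauses * by blast
    then show ?thesis using C1(2) C2(2) by (simp add: renames_def del: sat.simps fv.simps wf_fm.simps)
  qed
  moreover have "\<forall>\<chi>\<in>rcset (cUn C1 C2). wf_fm L \<chi> \<and> fv \<chi> \<subseteq> {..<n}"
  proof -
    have "wf_fm L \<chi> \<and> fv \<chi> \<subseteq> {..<n}" if "renames L n id \<psi> (Conj C)" "\<chi> \<in> rcset C" for C \<psi> \<chi>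
      using that wf_fm_member(1)[of \<chi> C L] fv_member(1)[of \<chi> C] unfolding renames_def by auto
    then show ?thesis using C1(2) C2(2) unfolding * by blast
  qed
  note ** = this
  ultimately show ?thesis using wf_fv_Conj[OF **] by blast
qed

text \<open>The maximum of two levels is one of them, so any property \<open>P\<close> of levels
  survives; it will be \<open>level\<close>. The empty family needs \<open>P\<close> at 0.\<close>

lemma Pi_fm_conj_finite:
  fixes S :: "('o::wellorder \<times> ('f, 'r) fm) set"
  assumes "finite S" and "P ord_zero"
    and "\<And>\<gamma> \<psi>. (\<gamma>, \<psi>) \<in> S \<Longrightarrow> P \<gamma> \<and> Pi_fm \<gamma> \<psi> \<and> wf_fm L \<psi> \<and> fv \<psi> \<subseteq> {..<n}"
  shows "\<exists>\<gamma> \<psi>. P \<gamma> \<and> Pi_fm \<gamma> \<psi> \<and> wf_fm L \<psi> \<and> fv \<psi> \<subseteq> {..<n} \<and>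
    (\<forall>(M :: ('f, 'r, nat) struct) e. sat M \<psi> e \<longleftrightarrow> (\<forall>\<chi>\<in>snd ` S. sat M \<chi> e))"
  using assms(1,3)
proof (induction S)
  case empty
  have *: "rcset (acset {}) = {}" by (simp add: rcset_acset)
  have "Pi_fm ord_zero (Conj (acset {}))"
    by (auto intro!: Sigma_fm_Pi_fm.intros finitary_qf.intros simp: *)
  moreover have "wf_fm L (Conj (acset {}))" "fv (Conj (acset {})) \<subseteq> {..<n}"
    unfolding cset_clauses * by simp_all
  moreover have "sat M (Conj (acset {})) e" for M :: "('f, 'r, nat) struct" and e
    unfolding cset_clauses * by simp
  ultimately show ?case using assms(2) by (metis empty_iff image_empty)
next
  case (insert x S)
  obtain \<gamma> \<psi> where x: "x = (\<gamma>, \<psi>)" by fastforce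
  have 1: "P \<gamma>" "Pi_fm \<gamma> \<psi>" "wf_fm L \<psi>" "fv \<psi> \<subseteq> {..<n}" using insert.prems x by auto
  obtain \<gamma>' \<psi>' where 2: "P \<gamma>'" "Pi_fm \<gamma>' \<psi>'" "wf_fm L \<psi>'" "fv \<psi>' \<subseteq> {..<n}"
    "\<And>(M :: ('f, 'r, nat) struct) e. sat M \<psi>' e \<longleftrightarrow> (\<forall>\<chi>\<in>snd ` S. sat M \<chi> e)"
    using insert by (metis insertI2)
  obtain \<psi>'' where 3: "Pi_fm (max \<gamma> \<gamma>') \<psi>''" "wf_fm L \<psi>''" "fv \<psi>'' \<subseteq> {..<n}"
    "\<And>(M :: ('f, 'r, nat) struct) e. sat M \<psi>'' e \<longleftrightarrow> sat M \<psi> e \<and> sat M \<psi>' e"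
    using Pi_fm_conj[OF 1(2-4) 2(2-4)] by blast
  show ?case
    using 1(1) 2(1,5) 3 by (intro exI[of _ "max \<gamma> \<gamma>'"] exI[of _ \<psi>'']) (auto simp: x max_def)
qed

section \<open>Existential quantification inside the hierarchy\<close>

text \<open>A positive level of the \<Sigma> hierarchy contains disjunctions only, so the block is
  wrapped in a singleton disjunction.\<close>

lemma Ex_block_Sigma:
  fixes \<beta> :: "'o::wellorder"
  assumes "Pi_fm \<gamma> \<psi>" "\<gamma> < \<beta>" "wf_fm L \<psi>" "fv \<psi> - set us \<subseteq> {..<n}"
  shows "\<exists>\<theta>. Sigma_fm \<beta> \<theta> \<and> wf_fm L \<theta> \<and> fv \<theta> \<subseteq> {..<n} \<and>
    (\<forall>(M :: ('f, 'r, nat) struct) e. sat M \<theta> e \<longleftrightarrow>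
      (\<exists>vs. length vs = length us \<and> sat M \<psi> (upds e us vs)))"
proof -
  let ?\<chi> = "foldr Ex us \<psi>"
  have *: "rcset (acset {?\<chi>}) = {?\<chi>}" by (simp add: rcset_acset)
  have "Sigma_fm \<beta> (Disj (acset {?\<chi>}))"
    using assms(1,2) ord_zero_le[of \<gamma>]
    by (intro Sigma_fm_Pi_fm.intros(3)) (auto simp: *)
  moreover have "sat M (Disj (acset {?\<chi>})) e \<longleftrightarrow>
      (\<exists>vs. length vs = length us \<and> sat M \<psi> (upds e us vs))" for M :: "('f, 'r, nat) struct" and e
    unfolding cset_clauses * by (simp add: sat_foldr_Ex)
  moreover have **: "\<forall>\<chi>\<in>rcset (acset {?\<chi>}). wf_fm L \<chi> \<and> fv \<chi> \<subseteq> {..<n}"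
    using assms by (simp add: *)
  ultimately show ?thesis using wf_fv_Disj[OF **] by blast
qed

text \<open>At a positive level the quantifier distributes over the disjunction and joins each
  block, leaving the level unchanged. A quantifier-free formula moves up to level
  \<open>\<beta>0\<close>, which is where 2 \<le> \<alpha> enters.\<close>

lemma Sigma_less_Ex:
  fixes \<alpha> :: "'o::wellorder"
  assumes "ord_zero < \<beta>0" "\<beta>0 < \<alpha>"
    and "Sigma_less_fm \<alpha> \<theta>" "wf_fm L \<theta>" "fv \<theta> \<subseteq> {..<Suc n}"
  shows "\<exists>\<theta>'. Sigma_less_fm \<alpha> \<theta>' \<and> wf_fm L \<theta>' \<and> fv \<theta>' \<subseteq> {..<n} \<and>
    (\<forall>(M :: ('f, 'r, nat) struct) e. sat M \<theta>' e \<longleftrightarrow> (\<exists>y. sat M \<theta> (e(n := y))))"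
proof -
  obtain \<beta> where \<beta>: "\<beta> < \<alpha>" "Sigma_fm \<beta> \<theta>" using assms(3) by (auto simp: Sigma_less_fm_def)
  have fv: "fv \<theta> - {n} \<subseteq> {..<n}" using assms(5) by (auto simp: lessThan_Suc)
  from \<beta>(2) show ?thesis
  proof (cases rule: Sigma_fm_cases)
    case 1
    obtain \<theta>' where "Sigma_fm \<beta>0 \<theta>'" "wf_fm L \<theta>'" "fv \<theta>' \<subseteq> {..<n}"
      "\<And>(M :: ('f, 'r, nat) struct) e. sat M \<theta>' e \<longleftrightarrow>
        (\<exists>vs. length vs = length [n] \<and> sat M \<theta> (upds e [n] vs))"
      using Ex_block_Sigma[of ord_zero \<theta> \<beta>0 L "[n]" n] 1(2) assms(1,4) fv Sigma_fm_Pi_fm.intros(2)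
      by (metis empty_set list.simps(15))
    moreover have "(\<exists>vs. length vs = length [n] \<and> sat M \<theta> (upds e [n] vs)) \<longleftrightarrow> (\<exists>y. sat M \<theta> (e(n := y)))"
      for M :: "('f, 'r, nat) struct" and e
      by (auto simp: quant_length_Suc simp del: fun_upd_apply)
    ultimately show ?thesis using assms(2) unfolding Sigma_less_fm_def by blast
  next
    case (2 C)
    let ?D = "Disj (cimage (Ex n) C)"
    have "\<exists>us \<psi> \<delta>. \<chi> = foldr Ex us \<psi> \<and> \<delta> < \<beta> \<and> Pi_fm \<delta> \<psi>" if \<chi>: "\<chi> \<in> Ex n ` rcset C" for \<chi>
    proof -
      obtain us \<psi> \<delta> where "\<chi> = Ex n (foldr Ex us \<psi>)" "\<delta> < \<beta>" "Pi_fm \<delta> \<psi>"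
        using \<chi> 2(3) by blast
      then show ?thesis by (intro exI[of _ "n # us"] exI[of _ \<psi>] exI[of _ \<delta>]) simp
    qed
    then have "Sigma_fm \<beta> ?D"
      using 2(1) by (intro Sigma_fm_Pi_fm.intros(3)) (simp_all add: cimage.rep_eq)
    moreover have "sat M ?D e \<longleftrightarrow> (\<exists>y. sat M \<theta> (e(n := y)))" for M :: "('f, 'r, nat) struct" and e
      unfolding 2(2) cset_clauses cimage.rep_eq by (auto simp del: fun_upd_apply)
    moreover have **: "\<forall>\<chi>\<in>rcset (cimage (Ex n) C). wf_fm L \<chi> \<and> fv \<chi> \<subseteq> {..<n}"
      using fv wf_fm_member(2)[of _ C L] fv_member(2)[of _ C] assms(4)
      unfolding 2(2) cimage.rep_eq by fastforce
    ultimately show ?thesis using wf_fv_Disj[OF **] \<beta>(1) unfolding Sigma_less_fm_def by blast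
  qed
qed

text \<open>The complements of \<open>S\<close> and of its image are infinite, so their increasing
  enumerations match them up. This turns finitely many distinct values satisfying a formula into a
  bijection as \<open>meets\<close> demands.\<close>

lemma inj_on_extends_to_bij:
  fixes f :: "nat \<Rightarrow> nat"
  assumes "finite S" and "inj_on f S"
  obtains e where "bij e" and "\<And>x. x \<in> S \<Longrightarrow> e x = f x"
proof -
  let ?T = "UNIV - S" and ?U = "UNIV - f ` S"
  have inf: "infinite ?T" "infinite ?U" using assms(1) by (simp_all add: Diff_infinite_finite)
  have "bij_betw (enumerate ?T) UNIV ?T" "bij_betw (enumerate ?U) UNIV ?U"
    using inf by (auto intro: bij_enumerate)
  then have g: "bij_betw (enumerate ?U \<circ> inv_into UNIV (enumerate ?T)) ?T ?U" (is "bij_betw ?g _ _")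
    by (meson bij_betw_inv_into bij_betw_trans)
  have "bij_betw f S (f ` S)" using assms(2) by (simp add: bij_betw_def)
  then have "bij_betw (\<lambda>x. if x \<in> S then f x else ?g x) (S \<union> ?T) (f ` S \<union> ?U)"
    using g by (rule bij_betw_disjoint_Un) auto
  then have "bij (\<lambda>x. if x \<in> S then f x else ?g x)" by simp
  then show thesis by (rule that) simp
qed

section \<open>Conditions\<close>

text \<open>The formulas evaluated here have their free variables below the length of the tuple, so
  the default 0 is never read.\<close>

definition env :: "nat list \<Rightarrow> nat \<Rightarrow> nat" where
  "env as i = (if i < length as then as ! i else 0)"

lemma env_map: "i < length as \<Longrightarrow> env (map h as) i = h (env as i)"
  by (simp add: env_def)

lemma map_env: "map (env as) [0..<length as] = as"
  by (intro nth_equalityI) (simp_all add: env_def)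

lemma sat_env_map:
  "fv \<phi> \<subseteq> {..<length as} \<Longrightarrow> sat M \<phi> (env (map h as)) = sat M \<phi> (h \<circ> env as)"
  by (rule sat_cong) (auto simp: env_map)

text \<open>The parameter \<open>\<beta>0\<close> is a witness for 2 \<le> \<alpha>.\<close>

locale scott_setting =
  fixes L :: "('f, 'r) language"
    and A :: "('f, 'r, nat) struct"
    and \<alpha> :: "'o::wellorder"
    and \<beta>0 :: 'o
  assumes one_le: "ord_zero < \<beta>0" and less_alpha: "\<beta>0 < \<alpha>"
begin

text \<open>This says \<gamma> + 1 < \<alpha> without a successor operation: a
  \<open>\<Pi>\<^sub>\<gamma>\<close> formula may be quantified existentially and still satisfy
  \<open>Sigma_less_fm\<close>.\<close>

definition level :: "'o \<Rightarrow> bool" where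
  "level \<gamma> \<longleftrightarrow> (\<exists>\<beta>. \<gamma> < \<beta> \<and> \<beta> < \<alpha>)"

lemma level_zero: "level ord_zero"
  using one_le less_alpha unfolding level_def by blast

lemma level_less: "level \<gamma> \<Longrightarrow> \<gamma> < \<alpha>"
  unfolding level_def by auto

definition sigma_def :: "nat \<Rightarrow> ('f, 'r) fm \<Rightarrow> bool" where
  "sigma_def n \<theta> \<longleftrightarrow> Sigma_less_fm \<alpha> \<theta> \<and> wf_fm L \<theta> \<and> fv \<theta> \<subseteq> {..<n}"

lemma sigma_def_qf: "finitary_qf \<theta> \<Longrightarrow> wf_fm L \<theta> \<Longrightarrow> fv \<theta> \<subseteq> {..<n} \<Longrightarrow> sigma_def n \<theta>"
  using one_le less_alpha Sigma_fm_Pi_fm.intros(1) unfolding sigma_def_def Sigma_less_fm_def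
  by (metis less_trans)

definition admissible :: "'o \<times> ('f, 'r) fm \<times> (nat \<Rightarrow> nat) \<Rightarrow> bool" where
  "admissible = (\<lambda>(\<gamma>, \<psi>, \<sigma>). level \<gamma> \<and> Pi_fm \<gamma> \<psi> \<and> wf_fm L \<psi>)"

lemma admissible_iff [simp]: "admissible (\<gamma>, \<psi>, \<sigma>) \<longleftrightarrow> level \<gamma> \<and> Pi_fm \<gamma> \<psi> \<and> wf_fm L \<psi>"
  by (simp add: admissible_def)

lemma admissible_qf: "finitary_qf \<psi> \<Longrightarrow> wf_fm L \<psi> \<Longrightarrow> admissible (ord_zero, \<psi>, \<sigma>)"
  by (simp add: level_zero Sigma_fm_Pi_fm.intros)

text \<open>A condition lists facts \<open>(\<gamma>, \<psi>, \<sigma>)\<close>: the \<open>\<Pi>\<^sub>\<gamma>\<close> formula \<open>\<psi>\<close> shall hold in the structure under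
  construction, whose universe is \<open>nat\<close>, under the assignment \<open>\<sigma>\<close>. Carrying \<open>\<sigma>\<close> along avoids
  substituting into formulas. Conditions are lists rather than sets so that the \<open>k\<close>-th fact of the
  generic sequence can be addressed: this keeps the family of dense requirements countable without
  fixing a countable fragment of the logic. Requiring bijections makes quotienting by equality
  unnecessary.\<close>

definition meets :: "('o \<times> ('f, 'r) fm \<times> (nat \<Rightarrow> nat)) list \<Rightarrow> (nat \<Rightarrow> nat) set" where
  "meets p = {e. bij e \<and> (\<forall>(\<gamma>, \<psi>, \<sigma>)\<in>set p. sat A \<psi> (e \<circ> \<sigma>))}"

definition condition :: "('o \<times> ('f, 'r) fm \<times> (nat \<Rightarrow> nat)) list \<Rightarrow> bool" where
  "condition p \<longleftrightarrow> (\<forall>x\<in>set p. admissible x) \<and> meets p \<noteq> {}"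

lemma meets_append: "meets (p @ q) = meets p \<inter> meets q"
  unfolding meets_def set_append ball_Un by blast

lemma meets_single: "meets [(\<gamma>, \<psi>, \<sigma>)] = {e. bij e \<and> sat A \<psi> (e \<circ> \<sigma>)}"
  by (simp add: meets_def)

lemma extend_condition:
  assumes "condition p" "admissible (\<gamma>, \<psi>, \<sigma>)" "e \<in> meets p" "sat A \<psi> (e \<circ> \<sigma>)"
  shows "condition (p @ [(\<gamma>, \<psi>, \<sigma>)])"
  using assms by (auto simp: condition_def meets_append meets_single meets_def simp del: o_apply)

text \<open>A formula cannot quantify over bijections, but \<open>p\<close> and \<open>c\<close>
  concern only the numbers below some \<open>N\<close>, so the values of \<open>e\<close> there
  suffice. Variables below \<open>?n\<close> hold the tuple \<open>b\<close>; variable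
  \<open>?n + i\<close> holds the value of \<open>e\<close> at \<open>i\<close> and is quantified
  away.\<close>

lemma realized_tuples_definable:
  assumes p: "\<forall>x\<in>set p. admissible x"
  obtains \<theta> where "sigma_def (length c) \<theta>"
    and "\<And>b. length b = length c \<Longrightarrow> sat A \<theta> (env b) \<longleftrightarrow> (\<exists>e\<in>meets p. map e c = b)"
proof -
  let ?n = "length c"
  have "finite ((\<Union>(\<gamma>, \<psi>, \<sigma>)\<in>set p. \<sigma> ` fv \<psi>) \<union> set c)"
    using p finite_fv by (fastforce simp: admissible_def)
  then obtain N where "(\<Union>(\<gamma>, \<psi>, \<sigma>)\<in>set p. \<sigma> ` fv \<psi>) \<union> set c \<subseteq> {..<N}"
    using finite_nat_iff_bounded by blast
  then have Nc: "\<And>i. i < ?n \<Longrightarrow> c ! i < N" and N: "\<And>\<gamma> \<psi> \<sigma>. (\<gamma>, \<psi>, \<sigma>) \<in> set p \<Longrightarrow> \<sigma> ` fv \<psi> \<subseteq> {..<N}"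
    using nth_mem by blast+
  \<comment> \<open>Renaming by the shifted \<sigma> absorbs the assignment of the fact into its
    formula.\<close>
  have "\<exists>\<psi>'. Pi_fm \<gamma> \<psi>' \<and> renames L (?n + N) (\<lambda>x. ?n + \<sigma> x) \<psi> \<psi>'" if "(\<gamma>, \<psi>, \<sigma>) \<in> set p" for \<gamma> \<psi> \<sigma>
  proof -
    have "admissible (\<gamma>, \<psi>, \<sigma>)" using p that by blast
    moreover have "(\<lambda>x. ?n + \<sigma> x) ` fv \<psi> \<subseteq> {..<?n + N}" using N[OF that] by auto
    ultimately show ?thesis
      using rename_Pi_Sigma[of L \<psi> "\<lambda>x. ?n + \<sigma> x" "?n + N" \<gamma>] unfolding admissible_iff by blast
  qed
  then have "\<forall>x. \<exists>\<psi>'. x \<in> set p \<longrightarrow> (case x of (\<gamma>, \<psi>, \<sigma>) \<Rightarrow>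
      Pi_fm \<gamma> \<psi>' \<and> renames L (?n + N) (\<lambda>x. ?n + \<sigma> x) \<psi> \<psi>')" by auto
  from choice[OF this] obtain g where "\<forall>x. x \<in> set p \<longrightarrow> (case x of (\<gamma>, \<psi>, \<sigma>) \<Rightarrow>
      Pi_fm \<gamma> (g x) \<and> renames L (?n + N) (\<lambda>x. ?n + \<sigma> x) \<psi> (g x))" ..
  then have g: "Pi_fm \<gamma> (g (\<gamma>, \<psi>, \<sigma>)) \<and> renames L (?n + N) (\<lambda>x. ?n + \<sigma> x) \<psi> (g (\<gamma>, \<psi>, \<sigma>))"
    if "(\<gamma>, \<psi>, \<sigma>) \<in> set p" for \<gamma> \<psi> \<sigma>
    using that by blast
  \<comment> \<open>In this order: the renamed facts, the distinctness of the \<open>N\<close>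
    values, and the equations making entry \<open>i\<close> of the tuple the value at
    \<open>c ! i\<close>.\<close>
  define S where "S = (\<lambda>x. (fst x, g x)) ` set p
    \<union> (\<lambda>(i, j). (ord_zero, Neg (Eq (Var (?n + i)) (Var (?n + j))))) ` (SIGMA i:{..<N}. {..<i})
    \<union> (\<lambda>i. (ord_zero, Eq (Var i) (Var (?n + c ! i)))) ` {..<?n}"
  have "finite S" unfolding S_def by simp
  moreover have "level \<gamma> \<and> Pi_fm \<gamma> \<psi> \<and> wf_fm L \<psi> \<and> fv \<psi> \<subseteq> {..<?n + N}" if "(\<gamma>, \<psi>) \<in> S" for \<gamma> \<psi>
    using that unfolding S_def
  proof (elim UnE)
    assume "(\<gamma>, \<psi>) \<in> (\<lambda>x. (fst x, g x)) ` set p"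
    then show ?thesis using p g by (force simp: admissible_def renames_def)
  qed (use Nc level_zero in \<open>auto intro!: Sigma_fm_Pi_fm.intros finitary_qf.intros\<close>)
  ultimately obtain \<gamma> \<Psi> where \<Psi>: "level \<gamma>" "Pi_fm \<gamma> \<Psi>" "wf_fm L \<Psi>" "fv \<Psi> \<subseteq> {..<?n + N}"
    and satS: "\<And>(M :: ('f, 'r, nat) struct) e. sat M \<Psi> e \<longleftrightarrow> (\<forall>\<chi>\<in>snd ` S. sat M \<chi> e)"
    using Pi_fm_conj_finite[of S level L "?n + N"] level_zero by blast
  obtain \<beta> where \<beta>: "\<gamma> < \<beta>" "\<beta> < \<alpha>" using \<Psi>(1) unfolding level_def by blast
  let ?vs = "[?n..<?n + N]"
  have "fv \<Psi> - set ?vs \<subseteq> {..<?n}" using \<Psi>(4) by auto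
  then obtain \<theta> where \<theta>: "Sigma_fm \<beta> \<theta>" "wf_fm L \<theta>" "fv \<theta> \<subseteq> {..<?n}"
    and sat\<theta>: "\<And>(M :: ('f, 'r, nat) struct) e. sat M \<theta> e \<longleftrightarrow>
      (\<exists>w. length w = length ?vs \<and> sat M \<Psi> (upds e ?vs w))"
    using Ex_block_Sigma[OF \<Psi>(2) \<beta>(1) \<Psi>(3)] by blast
  have sat_S: "sat A \<Psi> E \<longleftrightarrow> (\<forall>(\<gamma>, \<psi>, \<sigma>)\<in>set p. sat A \<psi> (E \<circ> (\<lambda>x. ?n + \<sigma> x)))
      \<and> (\<forall>i<N. \<forall>j<i. E (?n + i) \<noteq> E (?n + j)) \<and> (\<forall>i<?n. E i = E (?n + c ! i))" for E
  proof -
    have "(\<forall>x\<in>set p. sat A (g x) E) \<longleftrightarrow> (\<forall>(\<gamma>, \<psi>, \<sigma>)\<in>set p. sat A \<psi> (E \<circ> (\<lambda>x. ?n + \<sigma> x)))"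
    proof -
      have "sat A (g (\<gamma>, \<psi>, \<sigma>)) E = sat A \<psi> (E \<circ> (\<lambda>x. ?n + \<sigma> x))" if "(\<gamma>, \<psi>, \<sigma>) \<in> set p" for \<gamma> \<psi> \<sigma>
        using g[OF that] unfolding renames_def by blast
      then show ?thesis by (intro ball_cong) auto
    qed
    then have "(\<forall>\<chi>\<in>snd ` (\<lambda>x. (fst x, g x)) ` set p. sat A \<chi> E) \<longleftrightarrow>
        (\<forall>(\<gamma>, \<psi>, \<sigma>)\<in>set p. sat A \<psi> (E \<circ> (\<lambda>x. ?n + \<sigma> x)))"
      unfolding image_image snd_conv by simp
    moreover have "(\<forall>\<chi>\<in>snd ` (\<lambda>(i, j). (ord_zero :: 'o, Neg (Eq (Var (?n + i)) (Var (?n + j)))))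
        ` (SIGMA i:{..<N}. {..<i}). sat A \<chi> E) \<longleftrightarrow> (\<forall>i<N. \<forall>j<i. E (?n + i) \<noteq> E (?n + j))"
      by auto
    moreover have "(\<forall>\<chi>\<in>snd ` (\<lambda>i. (ord_zero :: 'o, Eq (Var i) (Var (?n + c ! i)))) ` {..<?n}. sat A \<chi> E)
        \<longleftrightarrow> (\<forall>i<?n. E i = E (?n + c ! i))"
      by auto
    ultimately show ?thesis unfolding satS S_def image_Un ball_Un by (simp only: conj_assoc)
  qed
  have "sat A \<theta> (env b) \<longleftrightarrow> (\<exists>e\<in>meets p. map e c = b)" if b: "length b = ?n" for b
  proof
    assume "sat A \<theta> (env b)"
    then obtain w where w: "length w = N" "sat A \<Psi> (upds (env b) ?vs w)" (is "sat A \<Psi> ?E")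
      unfolding sat\<theta> by auto
    have E1: "?E i = b ! i" if "i < ?n" for i using that b by (simp add: upds_notin env_def)
    \<comment> \<open>The inequalities make the values an injection on the numbers below
      \<open>N\<close>, which extends to a bijection.\<close>
    have "inj_on (\<lambda>i. ?E (?n + i)) {..<N}"
      using w(2) unfolding sat_S inj_on_def by (metis lessThan_iff nat_neq_iff)
    then obtain e where e: "bij e" "\<And>i. i < N \<Longrightarrow> e i = ?E (?n + i)"
      using inj_on_extends_to_bij[of "{..<N}" "\<lambda>i. ?E (?n + i)"] by auto
    have "sat A \<psi> (e \<circ> \<sigma>)" if x: "(\<gamma>, \<psi>, \<sigma>) \<in> set p" for \<gamma> \<psi> \<sigma>
    proof -
      have "sat A \<psi> (?E \<circ> (\<lambda>x. ?n + \<sigma> x))" using w(2) x unfolding sat_S by blast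
      moreover have "\<forall>x\<in>fv \<psi>. (e \<circ> \<sigma>) x = (?E \<circ> (\<lambda>x. ?n + \<sigma> x)) x"
        using N[OF x] e(2) by auto
      ultimately show ?thesis using sat_cong by blast
    qed
    then have "e \<in> meets p" using e(1) unfolding meets_def by blast
    moreover have "map e c = b"
    proof (intro nth_equalityI)
      fix i assume "i < length (map e c)"
      then have i: "i < ?n" by simp
      then have "c ! i < N" using Nc by blast
      moreover have "?E i = ?E (?n + c ! i)" using w(2) i unfolding sat_S by blast
      ultimately show "map e c ! i = b ! i" using e(2) E1[OF i] i by simp
    qed (simp add: b)
    ultimately show "\<exists>e\<in>meets p. map e c = b" by blast
  next
    assume "\<exists>e\<in>meets p. map e c = b"
    then obtain e where e: "e \<in> meets p" "map e c = b" by blast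
    let ?w = "map e [0..<N]"
    let ?E = "upds (env b) ?vs ?w"
    have E1: "?E i = b ! i" if "i < ?n" for i using that b by (simp add: upds_notin env_def)
    have "map ?E ?vs = ?w" by (rule map_upds_distinct) simp_all
    then have E2: "?E (?n + i) = e i" if "i < N" for i
      using that by (simp add: list_eq_iff_nth_eq)
    have "sat A \<psi> (?E \<circ> (\<lambda>x. ?n + \<sigma> x))" if x: "(\<gamma>, \<psi>, \<sigma>) \<in> set p" for \<gamma> \<psi> \<sigma>
    proof -
      have "sat A \<psi> (e \<circ> \<sigma>)" using e(1) x unfolding meets_def by blast
      moreover have "\<forall>x\<in>fv \<psi>. (e \<circ> \<sigma>) x = (?E \<circ> (\<lambda>x. ?n + \<sigma> x)) x"
        using N[OF x] E2 by auto
      ultimately show ?thesis using sat_cong by blast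
    qed
    moreover have "?E (?n + i) \<noteq> ?E (?n + j)" if "i < N" "j < i" for i j
      using that e(1) by (simp add: E2 meets_def bij_is_inj inj_eq)
    moreover have "?E i = ?E (?n + c ! i)" if i: "i < ?n" for i
    proof -
      have "c ! i < N" using Nc i by blast
      then show ?thesis using E1[OF i] E2 e(2) i by auto
    qed
    ultimately have "sat A \<Psi> ?E" unfolding sat_S by blast
    then show "sat A \<theta> (env b)" unfolding sat\<theta> by (intro exI[of _ ?w]) simp
  qed
  then show thesis
    using that \<theta> \<beta>(2) unfolding sigma_def_def Sigma_less_fm_def by blast
qed

text \<open>A true disjunct, with values for its block, yields a \<Pi> fact of level below \<delta>,
  hence an admissible one; at level 0 the formula itself is the fact. The implication holds in every
  structure, so it applies both to \<open>A\<close> and to the limit structure.\<close>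

lemma Sigma_witness:
  assumes "Sigma_fm \<delta> \<theta>" "\<delta> < \<alpha>" "wf_fm L \<theta>" and e: "bij e" "sat A \<theta> (e \<circ> \<tau>)"
  obtains \<gamma> \<pi> \<tau>' where "admissible (\<gamma>, \<pi>, \<tau>')" "\<gamma> \<le> \<delta>" "sat A \<pi> (e \<circ> \<tau>')"
    and "\<And>(M :: ('f, 'r, nat) struct) e'. sat M \<pi> (e' \<circ> \<tau>') \<Longrightarrow> sat M \<theta> (e' \<circ> \<tau>)"
  using assms(1)
proof (cases rule: Sigma_fm_cases)
  case 1
  then show ?thesis using that[OF admissible_qf[OF 1(2) assms(3)]] e(2) ord_zero_le by blast
next
  case (2 C)
  from e(2) obtain \<chi> where "\<chi> \<in> rcset C" "sat A \<chi> (e \<circ> \<tau>)"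
    unfolding 2(2) cset_clauses by blast
  moreover from this(1) obtain us \<pi> \<gamma> where "\<chi> = foldr Ex us \<pi>" "\<gamma> < \<delta>" "Pi_fm \<gamma> \<pi>"
    using 2(3) by blast
  ultimately have \<pi>: "foldr Ex us \<pi> \<in> rcset C" "\<gamma> < \<delta>" "Pi_fm \<gamma> \<pi>"
    and "sat A (foldr Ex us \<pi>) (e \<circ> \<tau>)"
    by simp_all
  then obtain vs where vs: "length vs = length us" "sat A \<pi> (upds (e \<circ> \<tau>) us vs)"
    unfolding sat_foldr_Ex by blast
  \<comment> \<open>The witnesses lie in \<open>A\<close>; since \<open>e\<close> is onto, they are
    pulled back to elements of the structure under construction.\<close>
  let ?\<tau> = "upds \<tau> us (map (inv e) vs)"
  have "map e (map (inv e) vs) = vs"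
    using e(1) by (simp add: bij_is_surj surj_f_inv_f map_idI)
  then have "e \<circ> ?\<tau> = upds (e \<circ> \<tau>) us vs" by (simp only: comp_upds)
  then have "sat A \<pi> (e \<circ> ?\<tau>)" using vs(2) by simp
  moreover have "wf_fm L \<pi>"
    using wf_fm_member(2)[OF \<pi>(1)] assms(3) 2(2) by auto
  then have "admissible (\<gamma>, \<pi>, ?\<tau>)" using \<pi> assms(2) unfolding admissible_iff level_def by blast
  moreover have "sat M \<theta> (e' \<circ> \<tau>)" if "sat M \<pi> (e' \<circ> ?\<tau>)" for M :: "('f, 'r, nat) struct" and e'
  proof -
    have "sat M (foldr Ex us \<pi>) (e' \<circ> \<tau>)"
      using that vs(1) unfolding comp_upds sat_foldr_Ex by (metis length_map)
    then show ?thesis using \<pi>(1) unfolding 2(2) cset_clauses by blast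
  qed
  ultimately show ?thesis using that \<pi>(2) by (meson less_imp_le)
qed

end

section \<open>Generic chains and limit structures\<close>

text \<open>Countably many dense requirements are enumerated and met one after another. It serves
  both the generic model and the back-and-forth construction.\<close>

lemma generic_chain:
  assumes "countable \<D>" "\<D> \<noteq> {}" "P p0"
    and dense: "\<And>D p. D \<in> \<D> \<Longrightarrow> P p \<Longrightarrow> \<exists>q. P q \<and> le p q \<and> D q"
  obtains s :: "nat \<Rightarrow> 'a" where "s 0 = p0" "\<And>t. P (s t)" "\<And>t. le (s t) (s (Suc t))"
    "\<And>D. D \<in> \<D> \<Longrightarrow> \<exists>t. D (s t)"
proof -
  let ?D = "from_nat_into \<D>"
  have "\<exists>s. \<forall>t. (P (s t) \<and> (t = 0 \<longrightarrow> s t = p0)) \<and> (le (s t) (s (Suc t)) \<and> ?D t (s (Suc t)))"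
  proof (rule dependent_nat_choice)
    show "\<exists>q. (P q \<and> (Suc t = 0 \<longrightarrow> q = p0)) \<and> (le p q \<and> ?D t q)"
      if "P p \<and> (t = 0 \<longrightarrow> p = p0)" for p t
      using dense[of "?D t" p] from_nat_into[OF assms(2), of t] that by auto
  qed (use assms(3) in auto)
  then obtain s where s: "\<And>t. P (s t)" "s 0 = p0" "\<And>t. le (s t) (s (Suc t))" "\<And>t. ?D t (s (Suc t))"
    by metis
  moreover have "\<exists>t. D (s t)" if "D \<in> \<D>" for D
    using s(4) from_nat_into_surj[OF assms(1) that] by metis
  ultimately show thesis using that by blast
qed

lemma prefix_chain:
  assumes "\<And>t. prefix (s t) (s (Suc t))" and "t \<le> t'"
  shows "prefix (s t) (s t')"
  using assms(2)
proof (induction rule: dec_induct)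
  case (step u)
  then show ?case using assms(1)[of u] prefix_order.order_trans by blast
qed simp

section \<open>The structure determined by a filter of bijections\<close>

text \<open>The structure of \<open>A\<close> is pulled back along the bijections \<open>e\<close>,
  keeping what holds for eventually all of them. The choice of \<open>m\<close> is meaningful once
  some value is eventually correct, which generic conditions ensure.\<close>

definition limit_struct ::
  "('f, 'r, nat) struct \<Rightarrow> (nat \<Rightarrow> nat) filter \<Rightarrow> ('f, 'r, nat) struct" where
  "limit_struct A F =
    \<lparr>fun_int = \<lambda>f ns. SOME m. \<forall>\<^sub>F e in F. e m = fun_int A f (map e ns),
     rel_int = \<lambda>R ns. \<forall>\<^sub>F e in F. rel_int A R (map e ns)\<rparr>"

context
  fixes L :: "('f, 'r) language" and A :: "('f, 'r, nat) struct" and F :: "(nat \<Rightarrow> nat) filter"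
  assumes bij: "\<forall>\<^sub>F e in F. bij e"
    and decide_fun: "\<And>f ns. f \<in> funs L \<Longrightarrow> length ns = farity L f \<Longrightarrow>
      \<exists>m. \<forall>\<^sub>F e in F. e m = fun_int A f (map e ns)"
    and decide_rel: "\<And>R ns. R \<in> rels L \<Longrightarrow> length ns = rarity L R \<Longrightarrow>
      (\<forall>\<^sub>F e in F. rel_int A R (map e ns)) \<or> (\<forall>\<^sub>F e in F. \<not> rel_int A R (map e ns))"
    and nontrivial: "F \<noteq> bot"
begin

lemma val_limit_struct:
  "wf_tm L t \<Longrightarrow> \<forall>\<^sub>F e in F. e (val (limit_struct A F) \<sigma> t) = val A (e \<circ> \<sigma>) t"
proof (induction t)
  case (App f ts)
  let ?ns = "map (val (limit_struct A F) \<sigma>) ts"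
  have f: "f \<in> funs L" "length ?ns = farity L f" using App.prems by auto
  have "\<forall>\<^sub>F e in F. \<forall>t\<in>set ts. e (val (limit_struct A F) \<sigma> t) = val A (e \<circ> \<sigma>) t"
    using App by (intro eventually_ball_finite) (auto simp: list_all_iff simp del: o_apply)
  moreover have "\<forall>\<^sub>F e in F. e (fun_int (limit_struct A F) f ?ns) = fun_int A f (map e ?ns)"
    using someI_ex[OF decide_fun[OF f]] by (simp add: limit_struct_def del: map_map)
  ultimately show ?case
  proof eventually_elim
    case (elim e)
    have "map e ?ns = map (val A (e \<circ> \<sigma>)) ts"
      using elim(1) by (intro nth_equalityI) (simp_all del: o_apply map_map)
    then show ?case using elim(2) by (simp del: o_apply map_map)
  qed
qed simp

text \<open>A quantifier-free analogue of the theorem of Los. Atomic questions are settled by the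
  hypotheses on \<open>F\<close>, and finite conjunctions and disjunctions are handled because
  filters are closed under finite intersections.\<close>

lemma sat_limit_struct:
  assumes "finitary_qf \<psi>"
  shows "wf_fm L \<psi> \<Longrightarrow> \<forall>\<^sub>F e in F. sat (limit_struct A F) \<psi> \<sigma> \<longleftrightarrow> sat A \<psi> (e \<circ> \<sigma>)"
  using assms
proof (induction \<psi> rule: finitary_qf.induct)
  case (1 s t)
  then have "\<forall>\<^sub>F e in F. e (val (limit_struct A F) \<sigma> s) = val A (e \<circ> \<sigma>) s"
    "\<forall>\<^sub>F e in F. e (val (limit_struct A F) \<sigma> t) = val A (e \<circ> \<sigma>) t"
    by (simp_all add: val_limit_struct del: o_apply)
  then show ?case using bij
  proof eventually_elim
    case (elim e)
    then show ?case using bij_is_inj[of e] by (simp add: inj_eq flip: elim(1,2) del: o_apply)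
  qed
next
  case (2 R ts)
  let ?ns = "map (val (limit_struct A F) \<sigma>) ts"
  have R: "R \<in> rels L" "length ?ns = rarity L R" using 2 by auto
  have "\<forall>\<^sub>F e in F. \<forall>t\<in>set ts. e (val (limit_struct A F) \<sigma> t) = val A (e \<circ> \<sigma>) t"
    using 2 val_limit_struct by (intro eventually_ball_finite) (auto simp del: o_apply)
  moreover have "\<forall>\<^sub>F e in F. rel_int (limit_struct A F) R ?ns \<longleftrightarrow> rel_int A R (map e ?ns)"
    using decide_rel[OF R]
  proof
    assume r: "\<forall>\<^sub>F e in F. rel_int A R (map e ?ns)"
    then show ?thesis by eventually_elim (use r in \<open>simp add: limit_struct_def del: map_map\<close>)
  next
    assume r: "\<forall>\<^sub>F e in F. \<not> rel_int A R (map e ?ns)"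
    \<comment> \<open>A relation and its negation can both hold eventually only in the improper
      filter.\<close>
    have "\<not> (\<forall>\<^sub>F e in F. rel_int A R (map e ?ns))"
    proof
      assume "\<forall>\<^sub>F e in F. rel_int A R (map e ?ns)"
      with r have "\<forall>\<^sub>F e in F. False" by eventually_elim (rule notE)
      with nontrivial show False by (simp only: eventually_False)
    qed
    then have "\<not> rel_int (limit_struct A F) R ?ns"
      by (simp add: limit_struct_def del: map_map)
    with r show ?thesis by (auto elim!: eventually_mono simp del: map_map)
  qed
  ultimately show ?case
  proof eventually_elim
    case (elim e)
    have "map e ?ns = map (val A (e \<circ> \<sigma>)) ts"
      using elim(1) by (intro nth_equalityI) (simp_all del: o_apply map_map)
    then show ?case using elim(2) by (simp del: o_apply map_map)
  qed
next
  case (3 \<psi>)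
  then show ?case by (simp del: o_apply)
next
  case (4 C)
  then have "\<forall>\<^sub>F e in F. \<forall>\<chi>\<in>rcset C. sat (limit_struct A F) \<chi> \<sigma> \<longleftrightarrow> sat A \<chi> (e \<circ> \<sigma>)"
    using wf_fm_member(1)[of _ C L] by (intro eventually_ball_finite) blast+
  then show ?case by eventually_elim (unfold cset_clauses, blast)
next
  case (5 C)
  then have "\<forall>\<^sub>F e in F. \<forall>\<chi>\<in>rcset C. sat (limit_struct A F) \<chi> \<sigma> \<longleftrightarrow> sat A \<chi> (e \<circ> \<sigma>)"
    using wf_fm_member(2)[of _ C L] by (intro eventually_ball_finite) blast+
  then show ?case by eventually_elim (unfold cset_clauses, blast)
qed

end


section \<open>Dense requirements\<close>

context scott_setting
begin

text \<open>The implication is required in all structures, so a fact found in \<open>A\<close> can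
  be used in the limit structure. The strict drop in level supports the induction there.\<close>

definition witnessed ::
  "'o \<Rightarrow> ('f, 'r) fm \<Rightarrow> (nat \<Rightarrow> nat) \<Rightarrow> ('o \<times> ('f, 'r) fm \<times> (nat \<Rightarrow> nat)) list \<Rightarrow> bool" where
  "witnessed \<gamma> \<theta> \<tau> p \<longleftrightarrow> (\<exists>\<gamma>' \<pi> \<tau>'. (\<gamma>', \<pi>, \<tau>') \<in> set p \<and> \<gamma>' < \<gamma> \<and>
    (\<forall>(M :: ('f, 'r, nat) struct) e. sat M \<pi> (e \<circ> \<tau>') \<longrightarrow> sat M \<theta> (e \<circ> \<tau>)))"

text \<open>One instance of the obligation to make a fact \<open>\<Pi>\<^sub>\<gamma>\<close> true: \<open>i\<close> selects a conjunct,
  \<open>us\<close> guesses its quantifier block and \<open>vs\<close> gives the values of the block. Indexing by \<open>us\<close>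
  fixes the matrix \<open>\<theta>\<close>, as the same conjunct may split into block and matrix in several ways.\<close>

definition fulfils ::
  "'o \<Rightarrow> ('f, 'r) fm \<Rightarrow> (nat \<Rightarrow> nat) \<Rightarrow> nat \<times> nat list \<times> nat list \<Rightarrow>
    ('o \<times> ('f, 'r) fm \<times> (nat \<Rightarrow> nat)) list \<Rightarrow> bool" where
  "fulfils \<gamma> \<psi> \<sigma> = (\<lambda>(i, us, vs) p. \<forall>C \<theta>. \<psi> = Conj C \<and> rcset C \<noteq> {} \<and>
    from_nat_into (rcset C) i = foldr All us \<theta> \<and> (\<exists>\<delta><\<gamma>. Sigma_fm \<delta> \<theta>) \<and> length vs = length us
    \<longrightarrow> witnessed \<gamma> \<theta> (upds \<sigma> us vs) p)"

definition fulfils_nth ::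
  "nat \<Rightarrow> nat \<times> nat list \<times> nat list \<Rightarrow> ('o \<times> ('f, 'r) fm \<times> (nat \<Rightarrow> nat)) list \<Rightarrow> bool" where
  "fulfils_nth k x p \<longleftrightarrow> k < length p \<and> (case p ! k of (\<gamma>, \<psi>, \<sigma>) \<Rightarrow> fulfils \<gamma> \<psi> \<sigma> x p)"

definition decides_fun ::
  "'f \<Rightarrow> nat list \<Rightarrow> ('o \<times> ('f, 'r) fm \<times> (nat \<Rightarrow> nat)) list \<Rightarrow> bool" where
  "decides_fun f ns p \<longleftrightarrow> length ns = farity L f \<longrightarrow>
    (\<exists>m. \<forall>e\<in>meets p. e m = fun_int A f (map e ns))"

definition decides_rel ::
  "'r \<Rightarrow> nat list \<Rightarrow> ('o \<times> ('f, 'r) fm \<times> (nat \<Rightarrow> nat)) list \<Rightarrow> bool" where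
  "decides_rel R ns p \<longleftrightarrow> length ns = rarity L R \<longrightarrow>
    (\<forall>e\<in>meets p. rel_int A R (map e ns)) \<or> (\<forall>e\<in>meets p. \<not> rel_int A R (map e ns))"

definition omits ::
  "nat list \<Rightarrow> nat list \<Rightarrow> ('o \<times> ('f, 'r) fm \<times> (nat \<Rightarrow> nat)) list \<Rightarrow> bool" where
  "omits as c p \<longleftrightarrow> (\<forall>e\<in>meets p. map e c \<noteq> as)"

definition supported :: "nat list \<Rightarrow> bool" where
  "supported as \<longleftrightarrow> (\<exists>\<theta>. sigma_def (length as) \<theta> \<and> sat A \<theta> (env as) \<and>
    (\<forall>bs \<eta>. length bs = length as \<and> sat A \<theta> (env bs) \<and> sigma_def (length as) \<eta> \<and> sat A \<eta> (env bs)
      \<longrightarrow> sat A \<eta> (env as)))"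

section \<open>Density of the requirements\<close>

lemma extend_dense:
  assumes "condition p" "admissible (\<gamma>, \<psi>, \<sigma>)" "e \<in> meets p" "sat A \<psi> (e \<circ> \<sigma>)"
    and "D (p @ [(\<gamma>, \<psi>, \<sigma>)])"
  shows "\<exists>q. condition q \<and> prefix p q \<and> D q"
  using extend_condition[OF assms(1-4)] assms(5) by (intro exI[of _ "p @ [(\<gamma>, \<psi>, \<sigma>)]"]) simp

text \<open>An obligation not yet fulfilled is an instance of a conjunct true in \<open>A\<close>
  under some \<open>e\<close> in \<open>meets p\<close>, and \<open>Sigma_witness\<close> turns it
  into one more fact. The bound \<gamma> \<le> \<alpha> covers the Scott sentence as well as the
  facts of conditions.\<close>

lemma dense_fulfils:
  assumes p: "condition p" and "\<gamma> \<le> \<alpha>" "wf_fm L \<psi>"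
    and sat: "\<And>e. e \<in> meets p \<Longrightarrow> sat A \<psi> (e \<circ> \<sigma>)"
  shows "\<exists>q. condition q \<and> prefix p q \<and> fulfils \<gamma> \<psi> \<sigma> x q"
proof (cases "fulfils \<gamma> \<psi> \<sigma> x p")
  case True
  then show ?thesis using p by blast
next
  case False
  obtain i us vs where x: "x = (i, us, vs)" using prod_cases3 by blast
  from False obtain C \<theta> \<delta> where C: "\<psi> = Conj C" "rcset C \<noteq> {}"
    "from_nat_into (rcset C) i = foldr All us \<theta>" "\<delta> < \<gamma>" "Sigma_fm \<delta> \<theta>" "length vs = length us"
    unfolding fulfils_def x by auto
  have mem: "foldr All us \<theta> \<in> rcset C" using from_nat_into[OF C(2), of i] C(3) by simp
  obtain e where e: "e \<in> meets p" using p unfolding condition_def by blast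
  then have "bij e" by (simp add: meets_def)
  have "sat A (foldr All us \<theta>) (e \<circ> \<sigma>)" using sat[OF e] mem unfolding C(1) cset_clauses by blast
  then have "sat A \<theta> (e \<circ> upds \<sigma> us vs)"
    using C(6) unfolding sat_foldr_All comp_upds by simp
  moreover have "wf_fm L \<theta>" using wf_fm_member(1)[OF mem] assms(3) C(1) by simp
  moreover have "\<delta> < \<alpha>" using C(4) assms(2) by simp
  ultimately obtain \<gamma>' \<pi> \<tau>' where w: "admissible (\<gamma>', \<pi>, \<tau>')" "\<gamma>' \<le> \<delta>" "sat A \<pi> (e \<circ> \<tau>')"
    "\<And>(M :: ('f, 'r, nat) struct) e'. sat M \<pi> (e' \<circ> \<tau>') \<Longrightarrow> sat M \<theta> (e' \<circ> upds \<sigma> us vs)"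
    using Sigma_witness[OF C(5)] \<open>bij e\<close> by blast
  let ?q = "p @ [(\<gamma>', \<pi>, \<tau>')]"
  have "witnessed \<gamma> \<theta> (upds \<sigma> us vs) ?q"
    unfolding witnessed_def using w(2,4) C(4)
    by (intro exI[of _ \<gamma>'] exI[of _ \<pi>] exI[of _ \<tau>']) auto
  \<comment> \<open>The conjunction is read off from \<open>\<psi>\<close>, and \<open>i\<close> and
    \<open>us\<close> then determine the matrix, so this single witness suffices.\<close>
  then have "fulfils \<gamma> \<psi> \<sigma> x ?q"
    using C(1,3) unfolding fulfils_def x by (auto simp: foldr_All_cancel)
  then show ?thesis using extend_dense[OF p w(1) e w(3)] by blast
qed

text \<open>Conditions can be padded with the empty conjunction, so every position is eventually
  occupied.\<close>

lemma dense_length: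
  assumes "condition p"
  shows "\<exists>q. condition q \<and> prefix p q \<and> k \<le> length q"
proof (induction k)
  case 0
  then show ?case using assms by auto
next
  case (Suc k)
  then obtain q where q: "condition q" "prefix p q" "k \<le> length q" by blast
  have triv: "rcset (acset {}) = {}" by (simp add: rcset_acset)
  have ok: "admissible (ord_zero, Conj (acset {}), id)"
    by (rule admissible_qf) (auto intro!: finitary_qf.intros simp: triv cset_clauses simp del: fv.simps wf_fm.simps)
  obtain e where "e \<in> meets q" using q(1) unfolding condition_def by blast
  then have "\<exists>q'. condition q' \<and> prefix q q' \<and> Suc k \<le> length q'"
    using q(3) by (intro extend_dense[OF q(1) ok]) (simp_all add: cset_clauses triv del: sat.simps)
  then show ?case using q(2) prefix_order.order_trans by blast
qed

lemma dense_fulfils_nth: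
  assumes "condition p"
  shows "\<exists>q. condition q \<and> prefix p q \<and> fulfils_nth k x q"
proof -
  obtain p' where p': "condition p'" "prefix p p'" "k < length p'"
    using dense_length[OF assms, of "Suc k"] by auto
  obtain \<gamma> \<psi> \<sigma> where k: "p' ! k = (\<gamma>, \<psi>, \<sigma>)" using prod_cases3 by blast
  then have mem: "(\<gamma>, \<psi>, \<sigma>) \<in> set p'" using p'(3) nth_mem by metis
  then have "admissible (\<gamma>, \<psi>, \<sigma>)" using p'(1) unfolding condition_def by blast
  then have "\<gamma> \<le> \<alpha>" "wf_fm L \<psi>" using level_less by (auto simp: less_imp_le)
  moreover have "\<And>e. e \<in> meets p' \<Longrightarrow> sat A \<psi> (e \<circ> \<sigma>)" using mem unfolding meets_def by blast
  ultimately obtain q where q: "condition q" "prefix p' q" "fulfils \<gamma> \<psi> \<sigma> x q"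
    using dense_fulfils[OF p'(1)] by blast
  have "q ! k = (\<gamma>, \<psi>, \<sigma>)" "k < length q"
    using q(2) p'(3) k by (auto simp: prefix_def nth_append)
  then have "fulfils_nth k x q" using q(3) unfolding fulfils_nth_def by simp
  then show ?thesis using q p' prefix_order.order_trans by blast
qed

lemma comp_env_upto: "map (e \<circ> env (ns @ ms)) [0..<length ns] = map e ns"
  by (intro nth_equalityI) (simp_all add: env_def nth_append)

lemma map_val_Vars: "map (val M e) (map Var is) = map e is"
  by simp

lemma dense_decides_fun:
  assumes "condition p" "f \<in> funs L"
  shows "\<exists>q. condition q \<and> prefix p q \<and> decides_fun f ns q"
proof (cases "length ns = farity L f")
  case True
  obtain e where e: "e \<in> meets p" using assms unfolding condition_def by blast
  then have "bij e" by (simp add: meets_def)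
  \<comment> \<open>Any bijection meeting \<open>p\<close> suggests a consistent value; the equation
    with that value becomes a fact of level 0.\<close>
  define m where "m = inv e (fun_int A f (map e ns))"
  have m: "e m = fun_int A f (map e ns)"
    using \<open>bij e\<close> by (simp add: m_def bij_is_surj surj_f_inv_f)
  define \<psi> :: "('f, 'r) fm" where "\<psi> = Eq (App f (map Var [0..<length ns])) (Var (length ns))"
  have *: "sat A \<psi> (e' \<circ> env (ns @ [m])) \<longleftrightarrow> fun_int A f (map e' ns) = e' m" for e'
  proof -
    have "(e' \<circ> env (ns @ [m])) (length ns) = e' m" by (simp add: env_def)
    then show ?thesis
      unfolding \<psi>_def sat.simps val.simps map_val_Vars comp_env_upto by simp
  qed
  have "admissible (ord_zero, \<psi>, env (ns @ [m]))"
    using assms(2) True by (intro admissible_qf) (auto simp: \<psi>_def list_all_iff intro: finitary_qf.intros)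
  moreover have "sat A \<psi> (e \<circ> env (ns @ [m]))" using m * by simp
  moreover have "decides_fun f ns (p @ [(ord_zero, \<psi>, env (ns @ [m]))])"
    unfolding decides_fun_def meets_append meets_single by (auto simp: * simp del: o_apply intro!: exI[of _ m])
  ultimately show ?thesis using extend_dense[OF assms(1) _ e] by blast
qed (use assms in \<open>auto simp: decides_fun_def\<close>)

lemma dense_decides_rel:
  assumes "condition p" "R \<in> rels L"
  shows "\<exists>q. condition q \<and> prefix p q \<and> decides_rel R ns q"
proof (cases "length ns = rarity L R")
  case True
  obtain e where e: "e \<in> meets p" using assms unfolding condition_def by blast
  define \<psi> :: "('f, 'r) fm" where "\<psi> = Rel R (map Var [0..<length ns])"
  have *: "sat A \<psi> (e' \<circ> env ns) \<longleftrightarrow> rel_int A R (map e' ns)" for e'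
    using comp_env_upto[of e' ns "[]"] unfolding \<psi>_def sat.simps map_val_Vars by simp
  have ok: "admissible (ord_zero, \<psi>, env ns)" "admissible (ord_zero, Neg \<psi>, env ns)"
    using assms(2) True by (auto simp: \<psi>_def intro!: admissible_qf finitary_qf.intros simp del: admissible_iff)
  show ?thesis
  proof (cases "sat A \<psi> (e \<circ> env ns)")
    case True
    have "decides_rel R ns (p @ [(ord_zero, \<psi>, env ns)])"
      unfolding decides_rel_def meets_append meets_single by (auto simp: * simp del: o_apply)
    then show ?thesis using extend_dense[OF assms(1) ok(1) e True] by blast
  next
    case False
    then have "sat A (Neg \<psi>) (e \<circ> env ns)" by (simp del: o_apply)
    moreover have "decides_rel R ns (p @ [(ord_zero, Neg \<psi>, env ns)])"
      unfolding decides_rel_def meets_append meets_single by (auto simp: * simp del: o_apply)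
    ultimately show ?thesis using extend_dense[OF assms(1) ok(2) e] by blast
  qed
qed (use assms in \<open>auto simp: decides_rel_def\<close>)

text \<open>If \<open>c\<close> can still play the role of \<open>as\<close>, then the formula
  defining the possible roles of \<open>c\<close> holds of \<open>as\<close> without supporting it.
  So another possible role \<open>b\<close> satisfies some \<open>\<eta>\<close> that fails at
  \<open>as\<close>; committing to a witness of \<open>\<eta>\<close> at \<open>c\<close> rules out
  the role \<open>as\<close>.\<close>

lemma dense_omits:
  assumes p: "condition p" and "\<not> supported as"
  shows "\<exists>q. condition q \<and> prefix p q \<and> omits as c q"
proof (cases "omits as c p")
  case True
  then show ?thesis using p by blast
next
  case False
  then obtain e0 where e0: "e0 \<in> meets p" "map e0 c = as" unfolding omits_def by blast
  then have len: "length c = length as" by auto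
  obtain \<theta> where \<theta>: "sigma_def (length c) \<theta>"
    "\<And>b. length b = length c \<Longrightarrow> sat A \<theta> (env b) \<longleftrightarrow> (\<exists>e\<in>meets p. map e c = b)"
    using realized_tuples_definable[of p c] p unfolding condition_def by metis
  have "sat A \<theta> (env as)" using \<theta>(2)[of as] e0 len by auto
  then obtain b \<eta> where b: "length b = length as" "sat A \<theta> (env b)" "sigma_def (length as) \<eta>"
    "sat A \<eta> (env b)" "\<not> sat A \<eta> (env as)"
    using assms(2) \<theta>(1) len unfolding supported_def by metis
  obtain e where e: "e \<in> meets p" "map e c = b" using \<theta>(2)[of b] b(1,2) len by auto
  obtain \<delta> where \<eta>: "\<delta> < \<alpha>" "Sigma_fm \<delta> \<eta>" "wf_fm L \<eta>" "fv \<eta> \<subseteq> {..<length c}"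
    using b(3) len unfolding sigma_def_def Sigma_less_fm_def by auto
  have "bij e" using e(1) by (simp add: meets_def)
  moreover have "sat A \<eta> (e \<circ> env c)" using b(4) e(2) sat_env_map[OF \<eta>(4)] by blast
  ultimately obtain \<gamma> \<pi> \<tau>' where w: "admissible (\<gamma>, \<pi>, \<tau>')" "sat A \<pi> (e \<circ> \<tau>')"
    "\<And>(M :: ('f, 'r, nat) struct) e'. sat M \<pi> (e' \<circ> \<tau>') \<Longrightarrow> sat M \<eta> (e' \<circ> env c)"
    using Sigma_witness[OF \<eta>(2,1,3), of e "env c"] by metis
  have "omits as c (p @ [(\<gamma>, \<pi>, \<tau>')])"
    unfolding omits_def meets_append meets_single
    using w(3)[of A] b(5) sat_env_map[OF \<eta>(4), of A] by blast
  then show ?thesis using extend_dense[OF p w(1) e(1) w(2)] by blast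
qed

text \<open>Each instance of each conjunct is implied by a fact of lower level, which is true by
  \<open>IH\<close>. Stating \<open>IH\<close> as a hypothesis lets the argument serve both the
  facts of conditions and the Scott sentence.\<close>

lemma fulfils_truth:
  assumes "Pi_fm \<gamma> \<psi>" "\<gamma> \<noteq> ord_zero"
    and fulfils: "\<And>x. \<exists>t. fulfils \<gamma> \<psi> \<sigma> x (s t)"
    and IH: "\<And>\<gamma>' \<pi> \<tau> t. (\<gamma>', \<pi>, \<tau>) \<in> set (s t) \<Longrightarrow> \<gamma>' < \<gamma> \<Longrightarrow> sat B \<pi> \<tau>"
  shows "sat B \<psi> \<sigma>"
  using assms(1)
proof (cases rule: Pi_fm_cases)
  case (2 C)
  have "sat B \<chi> \<sigma>" if \<chi>: "\<chi> \<in> rcset C" for \<chi>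
  proof -
    obtain us \<theta> \<delta> where us: "\<chi> = foldr All us \<theta>" "\<delta> < \<gamma>" "Sigma_fm \<delta> \<theta>" using 2(3) \<chi> by blast
    obtain i where i: "from_nat_into (rcset C) i = \<chi>"
      using from_nat_into_surj[of "rcset C" \<chi>] \<chi> by auto
    have "sat B \<theta> (upds \<sigma> us vs)" if "length vs = length us" for vs
    proof -
      obtain t where "fulfils \<gamma> \<psi> \<sigma> (i, us, vs) (s t)" using fulfils by blast
      then have "witnessed \<gamma> \<theta> (upds \<sigma> us vs) (s t)"
        using 2(2) \<chi> i us that unfolding fulfils_def by auto
      then obtain \<gamma>' \<pi> \<tau> where w: "(\<gamma>', \<pi>, \<tau>) \<in> set (s t)" "\<gamma>' < \<gamma>"
        "\<And>e. sat B \<pi> (e \<circ> \<tau>) \<Longrightarrow> sat B \<theta> (e \<circ> upds \<sigma> us vs)"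
        unfolding witnessed_def by blast
      \<comment> \<open>The assignments already take values in \<open>B\<close>, so the bijection is
        the identity.\<close>
      show ?thesis using IH[OF w(1,2)] w(3)[of id] by simp
    qed
    then show ?thesis unfolding us(1) sat_foldr_All by blast
  qed
  then show ?thesis unfolding 2(2) cset_clauses by blast
qed (use assms(2) in simp)

end

section \<open>Every tuple is supported\<close>

context scott_setting
begin

lemma all_supported:
  assumes L: "countable_language L" and \<phi>: "Pi_fm \<alpha> \<phi>" "scott_sentence L A \<phi>"
  shows "supported as"
proof (rule ccontr)
  assume unsupported: "\<not> supported as"
  have wf: "wf_fm L \<phi>" and fv: "fv \<phi> = {}" and scott: "\<And>B :: ('f, 'r, nat) struct. models B \<phi> \<longleftrightarrow> isomorphic L A B"
    using \<phi>(2) by (auto simp: scott_sentence_def sentence_def)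
  have A: "sat A \<phi> e" for e using scott[of A] isomorphic_refl unfolding models_def by blast
  \<comment> \<open>Requirements are indexed by numbers, lists and symbols of \<open>L\<close>, so
    there are countably many. The Scott sentence has level \<alpha> and cannot occur in a condition,
    so its obligations are listed separately; being a sentence, it may take any assignment.\<close>
  define \<D> where "\<D> = (\<lambda>(k, x). fulfils_nth k x) ` UNIV \<union> range (fulfils \<alpha> \<phi> (\<lambda>_. 0))
    \<union> (\<lambda>(f, ns). decides_fun f ns) ` (funs L \<times> UNIV)
    \<union> (\<lambda>(R, ns). decides_rel R ns) ` (rels L \<times> UNIV) \<union> range (omits as)"
  have "countable \<D>" using L unfolding \<D>_def countable_language_def by (intro countable_Un countable_image) auto
  moreover have "\<D> \<noteq> {}" unfolding \<D>_def by simp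
  moreover have "id \<in> meets []" by (simp add: meets_def)
  then have "condition []" unfolding condition_def by auto
  moreover have "\<exists>q. condition q \<and> prefix p q \<and> D q" if "D \<in> \<D>" "condition p" for D p
    using that(1) unfolding \<D>_def
  proof (elim UnE)
    assume "D \<in> (\<lambda>(k, x). fulfils_nth k x) ` UNIV"
    then show ?thesis using dense_fulfils_nth[OF that(2)] by auto
  next
    assume "D \<in> range (fulfils \<alpha> \<phi> (\<lambda>_. 0))"
    then show ?thesis using dense_fulfils[OF that(2) order_refl wf] A by auto
  next
    assume "D \<in> (\<lambda>(f, ns). decides_fun f ns) ` (funs L \<times> UNIV)"
    then show ?thesis using dense_decides_fun[OF that(2)] by auto
  next
    assume "D \<in> (\<lambda>(R, ns). decides_rel R ns) ` (rels L \<times> UNIV)"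
    then show ?thesis using dense_decides_rel[OF that(2)] by auto
  next
    assume "D \<in> range (omits as)"
    then show ?thesis using dense_omits[OF that(2) unsupported] by auto
  qed
  ultimately obtain s where s: "\<And>t. condition (s t)" "\<And>t. prefix (s t) (s (Suc t))"
    and generic: "\<And>D. D \<in> \<D> \<Longrightarrow> \<exists>t. D (s t)"
    using generic_chain[of \<D> condition "[]" prefix] by metis
  have mono: "prefix (s t) (s t')" if "t \<le> t'" for t t' using prefix_chain[of s, OF s(2) that] .
  have meets_mono: "meets (s t') \<subseteq> meets (s t)" if "t \<le> t'" for t t'
    using mono[OF that] by (auto simp: prefix_def meets_append)

  define F where "F = (INF t. principal (meets (s t)))"
  \<comment> \<open>The sets \<open>meets (s t)\<close> decrease, so they form a filter base:
    holding eventually means being forced at some stage.\<close>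
  have ev: "(\<forall>\<^sub>F e in F. P e) \<longleftrightarrow> (\<exists>t. \<forall>e\<in>meets (s t). P e)" for P
  proof -
    have "\<exists>u\<in>UNIV. principal (meets (s u)) \<le> inf (principal (meets (s t))) (principal (meets (s t')))" for t t'
      using meets_mono[of t "max t t'"] meets_mono[of t' "max t t'"]
      by (intro bexI[of _ "max t t'"]) auto
    then show ?thesis unfolding F_def by (subst eventually_INF_base) (auto simp: eventually_principal)
  qed
  have bij: "\<forall>\<^sub>F e in F. bij e" unfolding ev by (auto simp: meets_def)
  have nontrivial: "F \<noteq> bot"
    using s(1) unfolding eventually_False[symmetric] ev condition_def by blast
  have decide_fun: "\<exists>m. \<forall>\<^sub>F e in F. e m = fun_int A f (map e ns)"
    if "f \<in> funs L" "length ns = farity L f" for f ns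
    using generic[of "decides_fun f ns"] that unfolding ev decides_fun_def \<D>_def by fast
  have decide_rel: "(\<forall>\<^sub>F e in F. rel_int A R (map e ns)) \<or> (\<forall>\<^sub>F e in F. \<not> rel_int A R (map e ns))"
    if "R \<in> rels L" "length ns = rarity L R" for R ns
    using generic[of "decides_rel R ns"] that unfolding ev decides_rel_def \<D>_def by fast
  define B where "B = limit_struct A F"
  have committed: "sat B \<psi> \<sigma>" if "(\<gamma>, \<psi>, \<sigma>) \<in> set (s t)" for \<gamma> \<psi> \<sigma> t
    using that
  proof (induction \<gamma> arbitrary: \<psi> \<sigma> t rule: less_induct)
    case (less \<gamma>)
    have ok: "Pi_fm \<gamma> \<psi>" "wf_fm L \<psi>" using s(1)[of t] less.prems unfolding condition_def by auto
    show ?case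
    proof (cases "\<gamma> = ord_zero")
      case True
      then have "finitary_qf \<psi>" using ok(1) by (auto elim: Pi_fm_cases)
      then have "\<forall>\<^sub>F e in F. sat B \<psi> \<sigma> \<longleftrightarrow> sat A \<psi> (e \<circ> \<sigma>)"
        unfolding B_def using sat_limit_struct[OF bij decide_fun decide_rel nontrivial] ok(2) by blast
      moreover have "\<forall>\<^sub>F e in F. sat A \<psi> (e \<circ> \<sigma>)"
        unfolding ev using less.prems by (intro exI[of _ t]) (auto simp: meets_def simp del: o_apply)
      ultimately have "\<forall>\<^sub>F e in F. sat B \<psi> \<sigma>" by eventually_elim blast
      then show ?thesis using eventually_const[OF nontrivial] by blast
    next
      case False
      \<comment> \<open>Requirements address facts by position. Stages are comparable prefixes, so
        position \<open>k\<close> holds the same fact at stage \<open>u\<close>.\<close>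
      obtain k where k: "k < length (s t)" "s t ! k = (\<gamma>, \<psi>, \<sigma>)"
        using less.prems by (auto simp: in_set_conv_nth)
      have "\<exists>u. fulfils \<gamma> \<psi> \<sigma> x (s u)" for x
      proof -
        have "(\<lambda>(k, x). fulfils_nth k x) (k, x) \<in> \<D>" unfolding \<D>_def by blast
        then obtain u where u: "fulfils_nth k x (s u)" using generic by fastforce
        then have "k < length (s u)" unfolding fulfils_nth_def by blast
        then have "s u ! k = s t ! k"
          using k(1) mono[of t u] mono[of u t] nat_le_linear[of t u]
          by (auto simp: prefix_def nth_append)
        then show ?thesis using u k(2) unfolding fulfils_nth_def by auto
      qed
      then show ?thesis using fulfils_truth[OF ok(1) False] less.IH by blast
    qed
  qed
  have "sat B \<phi> (\<lambda>_. 0)"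
  proof (rule fulfils_truth[OF \<phi>(1)])
    show "\<alpha> \<noteq> ord_zero" using one_le less_alpha ord_zero_le[of \<beta>0] by auto
    show "\<exists>t. fulfils \<alpha> \<phi> (\<lambda>_. 0) x (s t)" for x
      using generic[of "fulfils \<alpha> \<phi> (\<lambda>_. 0) x"] unfolding \<D>_def by blast
  qed (rule committed)
  then have "models B \<phi>" unfolding models_def using sat_cong[of \<phi>] fv by blast
  then obtain h where h: "is_iso L A B h" using scott unfolding isomorphic_def by blast
  then have "bij h" by (simp add: is_iso_def)
  obtain t where t: "omits as (map h as) (s t)"
    using generic[of "omits as (map h as)"] unfolding \<D>_def by blast
  \<comment> \<open>All committed facts hold in \<open>B\<close>, and the isomorphism carries them
    to \<open>A\<close>. Thus \<open>inv h\<close> meets every stage while sending the image of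
    \<open>as\<close> back to \<open>as\<close>, which some stage forbids.\<close>
  have "sat A \<psi> (inv h \<circ> \<sigma>)" if x: "(\<gamma>, \<psi>, \<sigma>) \<in> set (s t)" for \<gamma> \<psi> \<sigma>
  proof -
    have "wf_fm L \<psi>" using s(1)[of t] x unfolding condition_def by auto
    moreover have "h \<circ> (inv h \<circ> \<sigma>) = \<sigma>"
      using \<open>bij h\<close> by (simp add: fun_eq_iff bij_is_surj surj_f_inv_f)
    ultimately show ?thesis using sat_iso[OF h, of \<psi> "inv h \<circ> \<sigma>"] committed[OF x] by simp
  qed
  then have "inv h \<in> meets (s t)"
    unfolding meets_def using \<open>bij h\<close> bij_imp_bij_inv by blast
  moreover have "map (inv h) (map h as) = as"
    using \<open>bij h\<close> by (simp add: bij_is_inj)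
  ultimately show False using t unfolding omits_def by blast
qed

end


section \<open>Back and forth between supported tuples\<close>

lemma env_snoc: "env (as @ [c]) = (env as)(length as := c)"
  by (auto simp: env_def fun_eq_iff nth_append)

locale supported_setting = scott_setting L A \<alpha> \<beta>0
  for L :: "('f, 'r) language" and A :: "('f, 'r, nat) struct" and \<alpha> \<beta>0 :: "'o::wellorder" +
  assumes supported: "\<And>as. supported as"
begin

definition support :: "nat list \<Rightarrow> ('f, 'r) fm" where
  "support as = (SOME \<theta>. sigma_def (length as) \<theta> \<and> sat A \<theta> (env as) \<and>
    (\<forall>bs \<eta>. length bs = length as \<and> sat A \<theta> (env bs) \<and> sigma_def (length as) \<eta> \<and> sat A \<eta> (env bs)
      \<longrightarrow> sat A \<eta> (env as)))"

lemma support: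
  "sigma_def (length as) (support as)" "sat A (support as) (env as)"
  "length bs = length as \<Longrightarrow> sat A (support as) (env bs) \<Longrightarrow> sigma_def (length as) \<eta> \<Longrightarrow>
    sat A \<eta> (env bs) \<Longrightarrow> sat A \<eta> (env as)"
  using someI_ex[OF supported[of as, unfolded supported_def], folded support_def] by blast+

definition sim :: "nat list \<Rightarrow> nat list \<Rightarrow> bool" where
  "sim as bs \<longleftrightarrow> length bs = length as \<and> sat A (support as) (env bs)"

text \<open>The support of \<open>bs\<close> is itself a \<open>\<Sigma>\<^bsub><\<alpha>\<^esub>\<close> formula true of \<open>bs\<close>, hence true of \<open>as\<close>.\<close>

lemma sim_sym:
  assumes "sim as bs"
  shows "sim bs as"
proof -
  have len: "length bs = length as" using assms by (simp add: sim_def)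
  have "sat A (support bs) (env as)"
    using support(3)[OF len _ _ support(2)] assms support(1)[of bs] len unfolding sim_def by simp
  then show ?thesis using len by (simp add: sim_def)
qed

lemma sim_sat:
  assumes "sim as bs" "sigma_def (length as) \<eta>"
  shows "sat A \<eta> (env as) \<longleftrightarrow> sat A \<eta> (env bs)"
  using assms sim_sym[OF assms(1)] support(3)[of bs as \<eta>] support(3)[of as bs \<eta>]
  unfolding sim_def by auto

text \<open>Quantifying away the last variable of the support of \<open>as @ [c]\<close> leaves a
  \<open>Sigma_less_fm\<close> formula true of \<open>as\<close>, hence of \<open>bs\<close>; its
  witness is \<open>d\<close>.\<close>

lemma sim_extend:
  assumes "sim as bs"
  shows "\<exists>d. sim (as @ [c]) (bs @ [d])"
proof -
  let ?n = "length as"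
  let ?\<theta> = "support (as @ [c])"
  have len: "length bs = ?n" using assms by (simp add: sim_def)
  have "sigma_def (Suc ?n) ?\<theta>" using support(1)[of "as @ [c]"] by simp
  then obtain \<eta> where \<eta>: "sigma_def ?n \<eta>"
    "\<And>(M :: ('f, 'r, nat) struct) e. sat M \<eta> e \<longleftrightarrow> (\<exists>y. sat M ?\<theta> (e(?n := y)))"
    using Sigma_less_Ex[OF one_le less_alpha, of ?\<theta> L ?n] unfolding sigma_def_def by blast
  have "sat A \<eta> (env as)" using \<eta>(2) support(2)[of "as @ [c]"] unfolding env_snoc by blast
  then have "sat A \<eta> (env bs)" using sim_sat[OF assms \<eta>(1)] by simp
  then obtain d where "sat A ?\<theta> ((env bs)(?n := d))" using \<eta>(2) by blast
  then have "sat A ?\<theta> (env (bs @ [d]))" unfolding env_snoc len .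
  then show ?thesis using len unfolding sim_def by auto
qed

section \<open>From related tuples to an automorphism\<close>

lemma sim_transfer:
  assumes "sim as bs" "finitary_qf \<psi>" "wf_fm L \<psi>" "fv \<psi> \<subseteq> {..<length as}"
  shows "sat A \<psi> (env as) \<longleftrightarrow> sat A \<psi> (env bs)"
  using sim_sat[OF assms(1) sigma_def_qf[OF assms(2-4)]] .

text \<open>Equations between variables transfer, so the finite correspondence is both single-valued
  and injective.\<close>

lemma sim_zip_eq:
  assumes "sim as bs" "(x, y) \<in> set (zip as bs)" "(x', y') \<in> set (zip as bs)"
  shows "x = x' \<longleftrightarrow> y = y'"
proof -
  have len: "length bs = length as" using assms by (simp add: sim_def)
  obtain i j where "i < length as" "j < length as" "as ! i = x" "as ! j = x'" "bs ! i = y" "bs ! j = y'"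
    using assms(2,3) by (auto simp: in_set_zip)
  then show ?thesis
    using sim_transfer[OF assms(1), of "Eq (Var i) (Var j)"] len
    by (simp add: finitary_qf.intros env_def)
qed

lemma zip_indices:
  assumes "\<forall>x\<in>S. (x, h x) \<in> set (zip as bs)" "length bs = length as"
  obtains idx where "\<And>x. x \<in> S \<Longrightarrow> idx x < length as \<and> env as (idx x) = x \<and> env bs (idx x) = h x"
proof -
  have "\<exists>i. i < length as \<and> env as i = x \<and> env bs i = h x" if "x \<in> S" for x
    using bspec[OF assms(1) that] assms(2) by (auto simp: in_set_zip env_def)
  then show thesis using that by metis
qed

text \<open>Related pairs of tuples are extended so that every number occurs on both sides. The
  union of the correspondences is a bijection, and it preserves the structure because
  quantifier-free formulas transfer at each finite stage.\<close>

lemma sim_iso: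
  assumes "sim as bs"
  shows "\<exists>h. is_iso L A A h \<and> map h as = bs"
proof -
  define le where "le = (\<lambda>p q :: nat list \<times> nat list. prefix (fst p) (fst q) \<and> prefix (snd p) (snd q))"
  define \<D> where "\<D> = range (\<lambda>x (p :: nat list \<times> nat list). x \<in> set (fst p))
    \<union> range (\<lambda>y (p :: nat list \<times> nat list). y \<in> set (snd p))"
  have "countable \<D>" "\<D> \<noteq> {}" unfolding \<D>_def by auto
  moreover have "(\<lambda>(as, bs). sim as bs) (as, bs)" using assms by simp
  moreover have "\<exists>q. (\<lambda>(as, bs). sim as bs) q \<and> le p q \<and> D q"
    if "D \<in> \<D>" "(\<lambda>(as, bs). sim as bs) p" for D p
  proof -
    obtain us vs where p: "p = (us, vs)" by fastforce
    have sim: "sim us vs" using that(2) p by simp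
    from that(1) consider x where "D = (\<lambda>p. x \<in> set (fst p))" | y where "D = (\<lambda>p. y \<in> set (snd p))"
      unfolding \<D>_def by auto
    then show ?thesis
    proof cases
      case (1 x)
      obtain y where "sim (us @ [x]) (vs @ [y])" using sim_extend[OF sim] by blast
      then show ?thesis by (intro exI[of _ "(us @ [x], vs @ [y])"]) (simp add: 1 p le_def)
    next
      case (2 y)
      \<comment> \<open>The back step is the forth step after exchanging the two tuples.\<close>
      obtain x where "sim (vs @ [y]) (us @ [x])" using sim_extend[OF sim_sym[OF sim]] by blast
      then have "sim (us @ [x]) (vs @ [y])" by (rule sim_sym)
      then show ?thesis by (intro exI[of _ "(us @ [x], vs @ [y])"]) (simp add: 2 p le_def)
    qed
  qed
  ultimately obtain s where s0: "s 0 = (as, bs)" and s: "\<And>t. (\<lambda>(as, bs). sim as bs) (s t)"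
    and step: "\<And>t. le (s t) (s (Suc t))" and generic: "\<And>D. D \<in> \<D> \<Longrightarrow> \<exists>t. D (s t)"
    using generic_chain[of \<D> "\<lambda>(as, bs). sim as bs" "(as, bs)" le] by metis
  define a b where "a t = fst (s t)" and "b t = snd (s t)" for t
  have sim: "sim (a t) (b t)" for t using s[of t] by (simp add: a_def b_def split_beta)
  then have len: "length (b t) = length (a t)" for t by (simp add: sim_def)
  have mono: "set (zip (a t) (b t)) \<subseteq> set (zip (a t') (b t'))" if "t \<le> t'" for t t'
  proof -
    have "prefix (a t) (a t')" "prefix (b t) (b t')"
      using prefix_chain[OF _ that, of a] prefix_chain[OF _ that, of b] step
      by (auto simp: a_def b_def le_def)
    then show ?thesis using len[of t] by (auto simp: prefix_def)
  qed
  define G where "G x y \<longleftrightarrow> (\<exists>t. (x, y) \<in> set (zip (a t) (b t)))" for x y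
  have G_eq: "x = x' \<longleftrightarrow> y = y'" if G: "G x y" "G x' y'" for x x' y y'
  proof -
    obtain t t' where "(x, y) \<in> set (zip (a t) (b t))" "(x', y') \<in> set (zip (a t') (b t'))"
      using G unfolding G_def by blast
    then show ?thesis
      using sim_zip_eq[OF sim, of x y "max t t'" x' y'] mono[of t "max t t'"] mono[of t' "max t t'"]
      by auto
  qed
  have left: "\<exists>y. G x y" for x
  proof -
    obtain t where "x \<in> set (a t)"
      using generic[of "\<lambda>p. x \<in> set (fst p)"] unfolding \<D>_def a_def by blast
    then show ?thesis using len[of t] unfolding G_def by (metis in_set_impl_in_set_zip1)
  qed
  have right: "\<exists>x. G x y" for y
  proof -
    obtain t where "y \<in> set (b t)"
      using generic[of "\<lambda>p. y \<in> set (snd p)"] unfolding \<D>_def b_def by blast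
    then show ?thesis using len[of t] unfolding G_def by (metis in_set_impl_in_set_zip2)
  qed
  obtain h where h: "\<And>x. G x (h x)" using left by metis
  have "bij h"
  proof (rule bijI)
    show "inj h" using G_eq[OF h h] by (auto intro: injI)
    show "surj h" using right G_eq[OF h] unfolding surj_def by metis
  qed
  have finite_stage: "\<exists>t. \<forall>x\<in>set xs. (x, h x) \<in> set (zip (a t) (b t))" for xs
  proof (induction xs)
    case (Cons x xs)
    then obtain t where t: "\<forall>x\<in>set xs. (x, h x) \<in> set (zip (a t) (b t))" by blast
    obtain t' where "(x, h x) \<in> set (zip (a t') (b t'))" using h unfolding G_def by blast
    then show ?case using t mono[of t "max t t'"] mono[of t' "max t t'"]
      by (intro exI[of _ "max t t'"]) auto
  qed simp
  have indices: "\<exists>t idx. \<forall>x\<in>set xs. idx x < length (a t) \<and> env (a t) (idx x) = x \<and> env (b t) (idx x) = h x"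
    for xs
  proof -
    obtain t where "\<forall>x\<in>set xs. (x, h x) \<in> set (zip (a t) (b t))" using finite_stage by blast
    from zip_indices[OF this len] show ?thesis by metis
  qed
  have "h (fun_int A f xs) = fun_int A f (map h xs)" if f: "f \<in> funs L" "length xs = farity L f" for f xs
  proof -
    let ?y = "fun_int A f xs"
    \<comment> \<open>The value \<open>?y\<close> is located along with the arguments, so one
      quantifier-free formula at one stage expresses the equation.\<close>
    obtain t idx where i: "\<forall>x\<in>set (?y # xs). idx x < length (a t) \<and> env (a t) (idx x) = x \<and> env (b t) (idx x) = h x"
      using indices by blast
    define \<psi> :: "('f, 'r) fm" where "\<psi> = Eq (App f (map Var (map idx xs))) (Var (idx ?y))"
    have "map (env (a t)) (map idx xs) = xs" "map (env (b t)) (map idx xs) = map h xs"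
      using i by (auto simp: map_idI)
    then have "sat A \<psi> (env (a t)) \<longleftrightarrow> fun_int A f xs = ?y"
      "sat A \<psi> (env (b t)) \<longleftrightarrow> fun_int A f (map h xs) = h ?y"
      unfolding \<psi>_def sat.simps val.simps map_val_Vars using i by (simp_all del: map_map)
    moreover have "sat A \<psi> (env (a t)) \<longleftrightarrow> sat A \<psi> (env (b t))"
      using f i by (intro sim_transfer[OF sim])
        (auto simp: \<psi>_def list_all_iff intro: finitary_qf.intros)
    ultimately show ?thesis by simp
  qed
  moreover have "rel_int A R xs \<longleftrightarrow> rel_int A R (map h xs)" if R: "R \<in> rels L" "length xs = rarity L R" for R xs
  proof -
    obtain t idx where i: "\<forall>x\<in>set xs. idx x < length (a t) \<and> env (a t) (idx x) = x \<and> env (b t) (idx x) = h x"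
      using indices by blast
    define \<psi> :: "('f, 'r) fm" where "\<psi> = Rel R (map Var (map idx xs))"
    have "map (env (a t)) (map idx xs) = xs" "map (env (b t)) (map idx xs) = map h xs"
      using i by (auto simp: map_idI)
    then have "sat A \<psi> (env (a t)) \<longleftrightarrow> rel_int A R xs"
      "sat A \<psi> (env (b t)) \<longleftrightarrow> rel_int A R (map h xs)"
      unfolding \<psi>_def sat.simps val.simps map_val_Vars by (simp_all del: map_map)
    moreover have "sat A \<psi> (env (a t)) \<longleftrightarrow> sat A \<psi> (env (b t))"
      using R i by (intro sim_transfer[OF sim]) (auto simp: \<psi>_def intro: finitary_qf.intros)
    ultimately show ?thesis by simp
  qed
  ultimately have "is_iso L A A h" using \<open>bij h\<close> unfolding is_iso_def by blast
  moreover have "map h as = bs"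
  proof (rule nth_equalityI)
    show "length (map h as) = length bs" using assms by (simp add: sim_def)
    fix i assume "i < length (map h as)"
    \<comment> \<open>The chain starts from the given pair, so the bijection extends it.\<close>
    then have "(as ! i, bs ! i) \<in> set (zip (a 0) (b 0))"
      using assms s0 by (auto simp: a_def b_def sim_def in_set_zip)
    then have "G (as ! i) (bs ! i)" unfolding G_def by blast
    then show "map h as ! i = bs ! i" using G_eq[OF h[of "as ! i"]] \<open>i < length (map h as)\<close> by auto
  qed
  ultimately show ?thesis by blast
qed

text \<open>Automorphisms preserve the support. Conversely, a tuple satisfying it is related to
  \<open>as\<close>, and \<open>sim_iso\<close> supplies the automorphism.\<close>

lemma support_defines_orbit: "defines_in L A (length as) (support as) (orbit L A as)"
proof -
  have \<theta>: "wf_fm L (support as)" "fv (support as) \<subseteq> {..<length as}"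
    using support(1)[of as] by (auto simp: sigma_def_def)
  have "bs \<in> orbit L A as \<longleftrightarrow> (\<exists>e. bs = map e [0..<length as] \<and> sat A (support as) e)" for bs
  proof
    assume "bs \<in> orbit L A as"
    then obtain h where h: "is_iso L A A h" "bs = map h as" unfolding orbit_def by blast
    have "sat A (support as) (h \<circ> env as)" using sat_iso[OF h(1) \<theta>(1)] support(2) by blast
    moreover have "bs = map (h \<circ> env as) [0..<length as]"
      using h(2) map_env[of as] by (metis map_map)
    ultimately show "\<exists>e. bs = map e [0..<length as] \<and> sat A (support as) e" by blast
  next
    assume "\<exists>e. bs = map e [0..<length as] \<and> sat A (support as) e"
    then obtain e where e: "bs = map e [0..<length as]" "sat A (support as) e" by blast
    have "\<forall>x\<in>fv (support as). e x = env bs x" using \<theta>(2) e(1) by (auto simp: env_def)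
    then have "sim as bs" using e sat_cong unfolding sim_def by (metis length_map length_upt minus_nat.diff_0)
    then show "bs \<in> orbit L A as" using sim_iso unfolding orbit_def by blast
  qed
  then show ?thesis using \<theta> unfolding defines_in_def by blast
qed

end

theorem theorem2p2:
  fixes L :: "('f, 'r) language"
    and A :: "('f, 'r, nat) struct"
    and \<alpha> :: "'o::wellorder"
  assumes "countable_language L"
    and "countable {..<\<alpha>}"
    and "\<exists>\<beta>. ord_zero < \<beta> \<and> \<beta> < \<alpha>"  (* 2 \<le> \<alpha> *)
    and "\<exists>\<phi>. Pi_fm \<alpha> \<phi> \<and> scott_sentence L A \<phi>"
  shows "\<forall>as :: nat list. \<exists>\<phi>. Sigma_less_fm \<alpha> \<phi> \<and> defines_in L A (length as) \<phi> (orbit L A as)"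
proof
  fix as :: "nat list"
  obtain \<beta> where \<beta>: "ord_zero < \<beta>" "\<beta> < \<alpha>" using assms(3) by blast
  obtain \<phi> where \<phi>: "Pi_fm \<alpha> \<phi>" "scott_sentence L A \<phi>" using assms(4) by blast
  interpret scott_setting L A \<alpha> \<beta> using \<beta> by unfold_locales
  interpret supported_setting L A \<alpha> \<beta>
    using all_supported[OF assms(1) \<phi>] by unfold_locales
  have "Sigma_less_fm \<alpha> (support as)" using support(1)[of as] by (simp add: sigma_def_def)
  then show "\<exists>\<phi>. Sigma_less_fm \<alpha> \<phi> \<and> defines_in L A (length as) \<phi> (orbit L A as)"
    using support_defines_orbit by blast
qed

end
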